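(* Let $c\in\mathbb{C}$ and let $n\geq 1$ be an integer. Let $f(z)$ be a nonconstant entire function of finite order such that $\Delta_c^n f(z)\not\equiv 0$, and let $a(z)\in S(f)$, $a(z)\not\equiv 0$, be a periodic entire function with period $c$. If $f(z)$, $\Delta_c^n f(z)$ and $\Delta_c^{n+1} f(z)$ share $a(z)$ CM, then $\Delta_c f(z)\equiv f(z)$.
   Context: Difference operators: for a meromorphic function $f$ in $\mathbb{C}$, $\Delta_c f(z)=f(z+c)-f(z)$ and $\Delta_c^n f(z)=\Delta_c^{n-1}(\Delta_c f(z))$ for $n\geq 2$. Let $T(r,f)$ be the Nevanlinna characteristic of $f$; finite order means $\rho(f)=\limsup_{r\to\infty}\frac{\log^+ T(r,f)}{\log r}<\infty$. $S(r,f)$ denotes any quantity that is $o(T(r,f))$ as $r\to\infty$ outside a possible exceptional set of finite logarithmic measure; a meromorphic function $\varphi$ is a small function of $f$ if $T(r,\varphi)=S(r,f)$, and $S(f)$ is the family of all small functions of $f$. Periodic with period $c$ means $a(z+c)\equiv a(z)$. Functions share $a(z)$ CM if the differences of these functions with $a(z)$ all have the same zeros, counting multiplicities. *)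

theory Defs
  imports "HOL-Complex_Analysis.Complex_Analysis" "HOL-Library.Landau_Symbols"
begin

definition log_plus :: "real \<Rightarrow> real" where
  "log_plus x = ln (max 1 x)"

definition proximity :: "real \<Rightarrow> (complex \<Rightarrow> complex) \<Rightarrow> real" where
  "proximity r f = integral {0..2 * pi} (\<lambda>\<theta>. log_plus (norm (f (rcis r \<theta>)))) / (2 * pi)"

text \<open>The number of poles in the closed disc of radius \<open>t\<close>, counted with multiplicity.
  The order of a pole is \<open>- zorder f z\<close>.\<close>

definition pole_count :: "real \<Rightarrow> (complex \<Rightarrow> complex) \<Rightarrow> nat" where
  "pole_count t f = (\<Sum>z\<in>{z \<in> cball 0 t. is_pole f z}. nat (- zorder f z))"

definition pole_counting :: "real \<Rightarrow> (complex \<Rightarrow> complex) \<Rightarrow> real" where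
  "pole_counting r f =
     integral {0..r} (\<lambda>t. (real (pole_count t f) - real (pole_count 0 f)) / t)
     + real (pole_count 0 f) * ln r"

definition nevanlinna_T :: "real \<Rightarrow> (complex \<Rightarrow> complex) \<Rightarrow> real" where
  "nevanlinna_T r f = proximity r f + pole_counting r f"

definition growth_order :: "(complex \<Rightarrow> complex) \<Rightarrow> ereal" where
  "growth_order f = Limsup at_top (\<lambda>r. ereal (log_plus (nevanlinna_T r f) / ln r))"

definition finite_log_measure :: "real set \<Rightarrow> bool" where
  "finite_log_measure E \<longleftrightarrow> E \<in> sets lebesgue \<and> E \<subseteq> {1<..} \<and>
     (\<integral>\<^sup>+r\<in>E. ennreal (1 / r) \<partial>lebesgue) < \<infinity>"

text \<open>\<open>is_S q f\<close> says that \<open>q(r) = S(r, f)\<close>; the filter is \<open>r\<close> tending to infinity outside \<open>E\<close>.\<close>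

definition is_S :: "(real \<Rightarrow> real) \<Rightarrow> (complex \<Rightarrow> complex) \<Rightarrow> bool" where
  "is_S q f \<longleftrightarrow> (\<exists>E. finite_log_measure E \<and>
     q \<in> o[inf at_top (principal (- E))](\<lambda>r. nevanlinna_T r f))"

definition small_functions :: "(complex \<Rightarrow> complex) \<Rightarrow> (complex \<Rightarrow> complex) set" where
  "small_functions f = {\<phi>. \<phi> meromorphic_on UNIV \<and> is_S (\<lambda>r. nevanlinna_T r \<phi>) f}"

definition difference :: "complex \<Rightarrow> (complex \<Rightarrow> complex) \<Rightarrow> complex \<Rightarrow> complex" where
  "difference c f = (\<lambda>z. f (z + c) - f z)"

text \<open>Sharing for entire functions. For an entire function that does not vanish identically,
  \<open>zorder\<close> at a zero is the multiplicity. \<open>zorder\<close> is unspecified for the zero function,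
  but by the first conjunct, if one of the differences vanishes identically then all do, and
  the second conjunct is then trivially true.\<close>

definition share_CM :: "(complex \<Rightarrow> complex) \<Rightarrow> (complex \<Rightarrow> complex) set \<Rightarrow> bool" where
  "share_CM a F \<longleftrightarrow> (\<forall>g\<in>F. \<forall>h\<in>F. \<forall>z.
     (g z - a z = 0 \<longleftrightarrow> h z - a z = 0) \<and>
     (g z - a z = 0 \<longrightarrow> zorder (\<lambda>w. g w - a w) z = zorder (\<lambda>w. h w - a w) z))"

end

theory Submission
  imports Defs
begin

text \<open>Write \<open>\<Delta>\<close> for the difference operator and \<open>G = \<Delta>\<^sup>n f - a\<close>. Sharing gives zero-free quotients
  \<open>G = e\<^sup>P (f - a)\<close> and \<open>\<Delta>\<^sup>n\<^sup>+\<^sup>1 f - a = e\<^sup>D G\<close>. On a suitable unbounded set of radii the proximity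
  functions of all functions involved grow polynomially (this is the only use of the smallness of
  \<open>a\<close>), so by the Poisson--Jensen inequality \<open>P\<close> and \<open>D\<close> are polynomials. As \<open>a\<close> is periodic,
  with \<open>v = e\<^sup>-\<^sup>P\<close> and \<open>w = e\<^sup>D\<close> one gets the exact system
  \<open>G(z + c) = a + (1 + w) G\<close> and \<open>\<Delta>\<^sup>n (v G) = a + G\<close>.
  The limit of \<open>G(z + k c) / a(z)\<close> along a ray on which \<open>w \<rightarrow> 0\<close> and \<open>v\<close> is well behaved would not
  depend on \<open>k\<close> and hence satisfy \<open>L = 1 + L\<close>; so \<open>D\<close> is constant. The only case
  without such a ray is that \<open>P\<close> and \<open>D\<close> are linear with positively proportional slopes and \<open>v\<close> has
  period \<open>c\<close>, which needs the rays with \<open>w \<rightarrow> \<infinity>\<close> too. For constant \<open>w\<close> the same method forces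
  \<open>v = w = 1\<close>, so that \<open>\<Delta>\<^sup>n f = f = \<Delta>\<^sup>n\<^sup>+\<^sup>1 f\<close>.\<close>

section \<open>The Poisson--Jensen inequality\<close>

text \<open>The argument lives on single orbits. For \<open>s k = G(z + k c) / a(z)\<close> the
  system reads \<open>s (k + 1) = 1 + (1 + w) s k\<close>, with \<open>w\<close> taken at the k-th
  orbit point, and the n-th difference of \<open>v s\<close> is \<open>1 + s\<close>. The obstacle
  is the existence of the limit of \<open>s j\<close>: solving for it divides by a coefficient that
  may itself tend to 0. If w -> 0 and v is normalised by its largest value near the orbit point, the
  limit coefficient is nonzero except when v -> infinity and v(z + c) = v(z), where it is an n-th
  difference of a constant. Then a ray with v -> 0 and w -> 0 has to be found instead, and
  positively proportional linear exponents are what prevents this. Polynomiality of the exponents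
  comes from killing high Taylor coefficients, for which one unbounded sequence of radii is enough;
  so an exceptional set of finite logarithmic measure does no harm, and the radii can also avoid the
  moduli of zeros, which keeps all integrands on circles continuous. Likewise, countably many
  directions can be discarded, so that the rays used meet no zero of \<open>a\<close> or of the n-th
  difference.\<close>

definition circle_mean :: "real \<Rightarrow> (complex \<Rightarrow> real) \<Rightarrow> real" where
  "circle_mean R u = integral {0..2 * pi} (\<lambda>\<theta>. u (rcis R \<theta>)) / (2 * pi)"

definition poisson_kernel :: "real \<Rightarrow> complex \<Rightarrow> complex \<Rightarrow> real" where
  "poisson_kernel R z \<zeta> = (R\<^sup>2 - (norm z)\<^sup>2) / (norm (\<zeta> - z))\<^sup>2"

lemma proximity_eq_circle_mean:
  "proximity R f = circle_mean R (\<lambda>\<zeta>. log_plus (norm (f \<zeta>)))"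
  by (simp add: proximity_def circle_mean_def)

lemma circle_integrable:
  fixes u :: "complex \<Rightarrow> 'a::banach"
  assumes "continuous_on (sphere 0 R) u" "R \<ge> 0"
  shows "(\<lambda>\<theta>. u (rcis R \<theta>)) integrable_on {0..2 * pi}"
proof -
  have "continuous_on {0..2*pi} (\<lambda>\<theta>. rcis R \<theta>)"
    unfolding rcis_def by (intro continuous_intros)
  moreover have "rcis R ` {0..2*pi} \<subseteq> sphere 0 R"
    using assms(2) by auto
  ultimately have "continuous_on {0..2*pi} (\<lambda>\<theta>. u (rcis R \<theta>))"
    using continuous_on_compose2[OF assms(1)] by blast
  then show ?thesis
    by (rule integrable_continuous_real)
qed

lemma circle_mean_mono:
  assumes "continuous_on (sphere 0 R) u" "continuous_on (sphere 0 R) v" "R \<ge> 0"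
    and "\<And>\<zeta>. norm \<zeta> = R \<Longrightarrow> u \<zeta> \<le> v \<zeta>"
  shows "circle_mean R u \<le> circle_mean R v"
  unfolding circle_mean_def
  by (intro divide_right_mono integral_le circle_integrable assms) (use assms(3) in auto)

lemma circle_mean_add:
  assumes "continuous_on (sphere 0 R) u" "continuous_on (sphere 0 R) v" "R \<ge> 0"
  shows "circle_mean R (\<lambda>\<zeta>. u \<zeta> + v \<zeta>) = circle_mean R u + circle_mean R v"
  unfolding circle_mean_def
  by (simp add: integral_add circle_integrable assms add_divide_distrib)

lemma circle_mean_diff:
  assumes "continuous_on (sphere 0 R) u" "continuous_on (sphere 0 R) v" "R \<ge> 0"
  shows "circle_mean R (\<lambda>\<zeta>. u \<zeta> - v \<zeta>) = circle_mean R u - circle_mean R v"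
  unfolding circle_mean_def
  by (simp add: integral_diff circle_integrable assms diff_divide_distrib)

lemma circle_mean_cmult: "circle_mean R (\<lambda>\<zeta>. k * u \<zeta>) = k * circle_mean R u"
  unfolding circle_mean_def by simp

lemma circle_mean_const: "circle_mean R (\<lambda>\<zeta>. k) = k"
  unfolding circle_mean_def by simp

lemma circle_mean_cong:
  assumes "\<And>\<zeta>. norm \<zeta> = R \<Longrightarrow> u \<zeta> = v \<zeta>" "R \<ge> 0"
  shows "circle_mean R u = circle_mean R v"
  unfolding circle_mean_def using assms by (intro arg_cong2[of _ _ _ _ "(/)"] integral_cong) auto

lemma continuous_poisson_kernel:
  assumes "norm z < R"
  shows "continuous_on (sphere 0 R) (poisson_kernel R z)"
  unfolding poisson_kernel_def
  by (intro continuous_intros) (use assms in auto)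

text \<open>Harnack's constants: the kernel lies between (R - |z|)/(R + |z|) and its reciprocal, and
  these are worst at |z| = R/2.\<close>

lemma poisson_kernel_bounds:
  assumes "norm z \<le> R / 2" "norm \<zeta> = R" "R > 0"
  shows "1 / 3 \<le> poisson_kernel R z \<zeta>" "poisson_kernel R z \<zeta> \<le> 3"
proof -
  have a: "R - norm z \<le> norm (\<zeta> - z)" "norm (\<zeta> - z) \<le> R + norm z"
    using assms norm_triangle_ineq2[of \<zeta> z] norm_triangle_ineq4[of \<zeta> z] by auto
  have pos: "0 < R - norm z" using assms by linarith
  have sq: "(R - norm z)\<^sup>2 \<le> (norm (\<zeta> - z))\<^sup>2" "(norm (\<zeta> - z))\<^sup>2 \<le> (R + norm z)\<^sup>2"
    using a pos by (auto intro!: power_mono)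
  have d: "(norm (\<zeta> - z))\<^sup>2 > 0" using a(1) pos by (intro zero_less_power) linarith
  have "(R + norm z)\<^sup>2 \<le> 3 * ((R + norm z) * (R - norm z))"
    unfolding power2_eq_square using assms(1)
    by (subst mult.left_commute, intro mult_left_mono) (use assms in auto)
  then show "1 / 3 \<le> poisson_kernel R z \<zeta>"
    unfolding poisson_kernel_def using sq d by (simp add: field_simps power2_eq_square)
  have "(R + norm z) * (R - norm z) \<le> 3 * (R - norm z)\<^sup>2"
    unfolding power2_eq_square mult.assoc[symmetric] using assms(1) pos
    by (intro mult_right_mono) auto
  then show "poisson_kernel R z \<zeta> \<le> 3"
    unfolding poisson_kernel_def using sq d by (simp add: field_simps power2_eq_square)
qed

lemma poisson_kernel_nonneg:
  assumes "norm z < R"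
  shows "0 \<le> poisson_kernel R z \<zeta>"
proof -
  have "(norm z)\<^sup>2 \<le> R\<^sup>2" using assms by (intro power_mono) auto
  then show ?thesis unfolding poisson_kernel_def by simp
qed

text \<open>On the circle, the kernel splits into the Cauchy kernel and a kernel that is holomorphic
  in the closed disc, so that the second part integrates to zero.\<close>

lemma poisson_kernel_split:
  assumes "norm z < R" "norm \<zeta> = R"
  shows "complex_of_real (poisson_kernel R z \<zeta>) =
    \<zeta> * (1 / (\<zeta> - z) + cnj z / (of_real (R\<^sup>2) - cnj z * \<zeta>))"
proof -
  have R: "of_real (R\<^sup>2) = \<zeta> * cnj \<zeta>"
    using complex_norm_square[of \<zeta>] assms(2) by simp
  have zz: "of_real ((norm z)\<^sup>2) = z * cnj z"
    using complex_norm_square[of z] by simp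
  have nz: "\<zeta> \<noteq> 0" "\<zeta> - z \<noteq> 0" "cnj \<zeta> - cnj z \<noteq> 0"
    using assms by auto
  have "\<zeta> * (1 / (\<zeta> - z) + cnj z / (\<zeta> * cnj \<zeta> - cnj z * \<zeta>)) =
      \<zeta> / (\<zeta> - z) + cnj z / (cnj \<zeta> - cnj z)"
  proof -
    have "\<zeta> * cnj \<zeta> - cnj z * \<zeta> = \<zeta> * (cnj \<zeta> - cnj z)" by (simp add: algebra_simps)
    then show ?thesis using nz by (simp add: distrib_left)
  qed
  also have "\<dots> = (\<zeta> * cnj \<zeta> - z * cnj z) / ((\<zeta> - z) * cnj (\<zeta> - z))"
    using nz by (simp add: field_simps)
  also have "\<dots> = of_real (poisson_kernel R z \<zeta>)"
    unfolding poisson_kernel_def of_real_divide of_real_diff R zz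
    by (metis complex_norm_square of_real_power)
  finally show ?thesis using R by simp
qed

text \<open>Cauchy's integral formula handles the first kernel of
  \<open>poisson_kernel_split\<close>, Cauchy's theorem the second.\<close>

lemma poisson_formula:
  fixes F :: "complex \<Rightarrow> complex"
  assumes F: "F holomorphic_on ball 0 R'" and "0 < R" "R < R'" "norm z < R"
  shows "((\<lambda>\<theta>. of_real (poisson_kernel R z (rcis R \<theta>)) * F (rcis R \<theta>)) has_integral
    2 * pi * F z) {0..2 * pi}"
proof -
  have sub: "cball 0 R \<subseteq> ball (0::complex) R'" using assms by auto
  have "((\<lambda>u. F u / (u - z)) has_contour_integral (2 * of_real pi * \<i> * F z)) (circlepath 0 R)"
    using assms sub
    by (intro Cauchy_integral_circlepath_simple holomorphic_on_subset[OF F]) auto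
  moreover have "((\<lambda>u. F u * (cnj z / (of_real (R\<^sup>2) - cnj z * u))) has_contour_integral 0)
      (circlepath 0 R)"
  proof (cases "z = 0")
    case True
    then show ?thesis by (simp add: has_contour_integral_is_0)
  next
    case False
    \<comment> \<open>The second kernel has its only pole at R^2 / cnj z, of modulus R^2 / |z| > R;
      the disc of radius \<open>R1\<close> stays clear of it.\<close>
    define R1 where "R1 = min R' (R\<^sup>2 / norm z)"
    have R1: "R < R1"
      unfolding R1_def using assms False by (simp add: power2_eq_square field_simps)
    have "(\<lambda>u. F u * (cnj z / (of_real (R\<^sup>2) - cnj z * u))) holomorphic_on ball 0 R1"
    proof (intro holomorphic_intros holomorphic_on_subset[OF F])
      show "ball 0 R1 \<subseteq> ball 0 R'" by (auto simp: R1_def)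
      fix u :: complex assume "u \<in> ball 0 R1"
      then have "norm u < R\<^sup>2 / norm z" by (simp add: R1_def)
      then have "norm (cnj z * u) < R\<^sup>2"
        using False by (simp add: norm_mult field_simps)
      then show "of_real (R\<^sup>2) - cnj z * u \<noteq> 0"
        by (metis norm_of_real abs_of_nonneg zero_le_power2 eq_iff_diff_eq_0 order_less_irrefl)
    qed
    then show ?thesis
      by (rule Cauchy_theorem_disc_simple) (use R1 assms in auto)
  qed
  ultimately have "((\<lambda>u. F u / (u - z) + F u * (cnj z / (of_real (R\<^sup>2) - cnj z * u)))
      has_contour_integral (2 * of_real pi * \<i> * F z + 0)) (circlepath 0 R)"
    by (rule has_contour_integral_add)
  then have "((\<lambda>t. (F (0 + R * cis t) / (0 + R * cis t - z) +
      F (0 + R * cis t) * (cnj z / (of_real (R\<^sup>2) - cnj z * (0 + R * cis t)))) * R * \<i> * cis t)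
      has_integral (2 * of_real pi * \<i> * F z)) {0..2 * pi}"
    unfolding circlepath_def by (subst (asm) has_contour_integral_part_circlepath_iff) auto
  \<comment> \<open>On the circle the differential of \<zeta> is \<i> \<zeta> dt, and the factor
    -\<i> removes the \<i>.\<close>
  then have "((\<lambda>t. - \<i> * ((F (0 + R * cis t) / (0 + R * cis t - z) +
      F (0 + R * cis t) * (cnj z / (of_real (R\<^sup>2) - cnj z * (0 + R * cis t)))) * R * \<i> * cis t))
      has_integral (- \<i> * (2 * of_real pi * \<i> * F z))) {0..2 * pi}"
    by (rule has_integral_mult_right)
  moreover have "- \<i> * (2 * of_real pi * \<i> * F z) = 2 * of_real pi * F z"
    by simp
  moreover have "- \<i> * ((F (0 + R * cis t) / (0 + R * cis t - z) +
      F (0 + R * cis t) * (cnj z / (of_real (R\<^sup>2) - cnj z * (0 + R * cis t)))) * R * \<i> * cis t) =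
      of_real (poisson_kernel R z (rcis R t)) * F (rcis R t)" for t
  proof -
    have "norm (rcis R t) = R" using assms by simp
    then show ?thesis
      unfolding poisson_kernel_split[OF assms(4) \<open>norm (rcis R t) = R\<close>]
      by (simp add: rcis_def algebra_simps)
  qed
  ultimately show ?thesis by (simp only: of_real_mult of_real_numeral)
qed

lemma poisson_mean_Re:
  fixes F :: "complex \<Rightarrow> complex"
  assumes F: "F holomorphic_on ball 0 R'" and "0 < R" "R < R'" "norm z < R"
  shows "circle_mean R (\<lambda>\<zeta>. poisson_kernel R z \<zeta> * Re (F \<zeta>)) = Re (F z)"
proof -
  have "((\<lambda>\<theta>. Re (of_real (poisson_kernel R z (rcis R \<theta>)) * F (rcis R \<theta>))) has_integral
    Re (2 * pi * F z)) {0..2 * pi}"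
    using has_integral_linear[OF poisson_formula[where F = F, OF assms] bounded_linear_Re]
    by (simp add: o_def)
  then have "((\<lambda>\<theta>. poisson_kernel R z (rcis R \<theta>) * Re (F (rcis R \<theta>))) has_integral
    2 * pi * Re (F z)) {0..2 * pi}"
    by simp
  from integral_unique[OF this] show ?thesis
    unfolding circle_mean_def by simp
qed

text \<open>A zero-free function on a disc has a holomorphic logarithm, whose real part is
  \<open>ln (norm (h w))\<close>.\<close>

lemma poisson_mean_ln_norm:
  assumes h: "h holomorphic_on ball 0 R'" and nz: "\<And>w. norm w < R' \<Longrightarrow> h w \<noteq> 0"
    and "0 < R" "R < R'" "norm z < R"
  shows "circle_mean R (\<lambda>\<zeta>. poisson_kernel R z \<zeta> * ln (norm (h \<zeta>))) = ln (norm (h z))"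
proof -
  obtain g where g: "g holomorphic_on ball 0 R'" "\<And>w. w \<in> ball 0 R' \<Longrightarrow> h w = exp (g w)"
    using contractible_imp_holomorphic_log[OF h] nz convex_imp_contractible[of "ball 0 R'"]
    by (metis convex_ball mem_ball_0)
  have ln: "ln (norm (h w)) = Re (g w)" if "norm w < R'" for w
    using g(2)[of w] that by simp
  have "circle_mean R (\<lambda>\<zeta>. poisson_kernel R z \<zeta> * ln (norm (h \<zeta>))) =
      circle_mean R (\<lambda>\<zeta>. poisson_kernel R z \<zeta> * Re (g \<zeta>))"
    by (rule circle_mean_cong) (use ln assms in auto)
  also have "\<dots> = Re (g z)"
    by (rule poisson_mean_Re[OF g(1)]) (use assms in auto)
  also have "\<dots> = ln (norm (h z))" using ln[of z] assms by simp
  finally show ?thesis .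
qed

text \<open>A factor with a zero \<open>b\<close> inside the disc is replaced by its reflection, which has the same
  modulus on the circle and no zeros inside.\<close>

lemma poisson_mean_linear:
  assumes "0 < R" "norm z < R" "norm b \<noteq> R" "z \<noteq> b"
  shows "ln (norm (z - b)) \<le> circle_mean R (\<lambda>\<zeta>. poisson_kernel R z \<zeta> * ln (norm (\<zeta> - b)))"
proof (cases "norm b > R")
  case True
  have "circle_mean R (\<lambda>\<zeta>. poisson_kernel R z \<zeta> * ln (norm (\<zeta> - b))) = ln (norm (z - b))"
    by (rule poisson_mean_ln_norm[of _ "norm b"]) (use assms True in \<open>auto intro!: holomorphic_intros\<close>)
  then show ?thesis by simp
next
  case False
  then have b: "norm b < R" using assms by simp
  \<comment> \<open>After division by R^2 this identity compares the reflected factor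
    \<open>h\<close> with w - b: equal moduli on the circle, where the last product vanishes, and
    \<open>h\<close> larger inside, where it is nonnegative.\<close>
  have cross: "(norm (of_real (R\<^sup>2) - cnj b * w))\<^sup>2 =
      R\<^sup>2 * (norm (w - b))\<^sup>2 + (R\<^sup>2 - (norm w)\<^sup>2) * (R\<^sup>2 - (norm b)\<^sup>2)" for w
    unfolding cmod_power2 by (simp add: algebra_simps power2_eq_square)
  define h where "h w = (of_real (R\<^sup>2) - cnj b * w) / of_real R" for w
  have hsq: "(norm (h w))\<^sup>2 = (norm (w - b))\<^sup>2 + (R\<^sup>2 - (norm w)\<^sup>2) * (R\<^sup>2 - (norm b)\<^sup>2) / R\<^sup>2" for w
    unfolding h_def norm_divide power_divide cross using assms(1) by (simp add: field_simps)
  have hcirc: "norm (h \<zeta>) = norm (\<zeta> - b)" if "norm \<zeta> = R" for \<zeta>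
    using hsq[of \<zeta>] that by (simp add: power2_eq_iff_nonneg)
  have hin: "norm (z - b) \<le> norm (h z)"
  proof (rule power2_le_imp_le)
    have "(norm z)\<^sup>2 \<le> R\<^sup>2" "(norm b)\<^sup>2 \<le> R\<^sup>2" using assms b by (auto intro!: power_mono)
    then show "(norm (z - b))\<^sup>2 \<le> (norm (h z))\<^sup>2" unfolding hsq by simp
  qed simp
  obtain R' where R': "R < R'" "R' * norm b < R\<^sup>2"
  proof (cases "b = 0")
    case True
    then show ?thesis using that[of "R + 1"] assms by simp
  next
    case False
    have "R < R\<^sup>2 / norm b" using b assms False by (simp add: power2_eq_square field_simps)
    then obtain R' where "R < R'" "R' < R\<^sup>2 / norm b" using dense by blast
    then show ?thesis using that False by (simp add: field_simps)
  qed
  have "circle_mean R (\<lambda>\<zeta>. poisson_kernel R z \<zeta> * ln (norm (h \<zeta>))) = ln (norm (h z))"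
  proof (rule poisson_mean_ln_norm[of _ R'])
    show "h holomorphic_on ball 0 R'"
      unfolding h_def using assms by (intro holomorphic_intros) auto
    fix w :: complex assume "norm w < R'"
    then have "norm (cnj b * w) \<le> R' * norm b"
      using mult_right_mono[of "norm w" R' "norm b"] by (simp add: norm_mult mult.commute)
    then have "norm (cnj b * w) < R\<^sup>2" using R' by linarith
    then show "h w \<noteq> 0"
      unfolding h_def using assms(1)
      by (metis norm_of_real abs_of_nonneg zero_le_power2 eq_iff_diff_eq_0 order_less_irrefl
          divide_eq_0_iff of_real_eq_0_iff)
  qed (use assms R' in auto)
  also have "circle_mean R (\<lambda>\<zeta>. poisson_kernel R z \<zeta> * ln (norm (h \<zeta>))) =
      circle_mean R (\<lambda>\<zeta>. poisson_kernel R z \<zeta> * ln (norm (\<zeta> - b)))"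
    by (rule circle_mean_cong) (use hcirc assms in auto)
  finally show ?thesis using hin assms by (simp add: ln_mono)
qed

lemma circle_mean_sum:
  assumes "finite I" "\<And>i. i \<in> I \<Longrightarrow> continuous_on (sphere 0 R) (u i)" "R \<ge> 0"
  shows "circle_mean R (\<lambda>\<zeta>. \<Sum>i\<in>I. u i \<zeta>) = (\<Sum>i\<in>I. circle_mean R (u i))"
  using assms(1,2)
proof (induction rule: finite_induct)
  case empty
  then show ?case by (simp add: circle_mean_const)
next
  case (insert i I)
  have "circle_mean R (\<lambda>\<zeta>. u i \<zeta> + (\<Sum>i\<in>I. u i \<zeta>)) =
      circle_mean R (u i) + circle_mean R (\<lambda>\<zeta>. \<Sum>i\<in>I. u i \<zeta>)"
    by (rule circle_mean_add) (use insert assms(3) in \<open>auto intro!: continuous_on_sum\<close>)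
  with insert show ?case by simp
qed

text \<open>The zeros are divided out by a polynomial \<open>Q\<close>. The zero-free cofactor gives
  an equality, and each linear factor errs in the same direction by
  \<open>poisson_mean_linear\<close>, so the sum is an inequality.\<close>

lemma poisson_jensen:
  assumes f: "f holomorphic_on UNIV" and "0 < R" "norm z < R" "f z \<noteq> 0"
    and nz: "\<And>\<zeta>. norm \<zeta> = R \<Longrightarrow> f \<zeta> \<noteq> 0"
  shows "ln (norm (f z)) \<le> circle_mean R (\<lambda>\<zeta>. poisson_kernel R z \<zeta> * ln (norm (f \<zeta>)))"
proof (cases "f constant_on UNIV")
  case True
  then obtain k where k: "\<And>w. f w = k" by (auto simp: constant_on_def)
  have "circle_mean R (\<lambda>\<zeta>. poisson_kernel R z \<zeta> * ln (norm (f \<zeta>))) = ln (norm (f z))"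
    by (rule poisson_mean_ln_norm[of _ "R + 1"])
       (use assms k in \<open>auto intro: holomorphic_on_subset[OF f]\<close>)
  then show ?thesis by simp
next
  case False
  \<comment> \<open>The larger disc makes the cofactor \<open>h\<close> zero-free on a neighbourhood
    of the closed disc; zeros of modulus between R and R + 1 are factored out as well.\<close>
  define A where "A = ball (0::complex) (R + 1)"
  define S where "S = {w \<in> A. f w = 0}"
  have "finite {w \<in> cball 0 (R + 1). f w = 0}"
    by (rule holomorphic_compact_finite_zeros[OF f]) (use False in auto)
  then have finS: "finite S"
    by (rule rev_finite_subset) (auto simp: S_def A_def)
  define m where "m b = nat (zorder f b)" for b
  define Q where "Q w = (\<Prod>b\<in>S. (w - b) ^ m b)" for w
  have ev: "eventually (\<lambda>w. f w \<noteq> 0) (at b)" for b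
    using non_zero_neighbour_alt[OF f, of b z] assms by (auto elim: eventually_mono)
  have ana: "f analytic_on {b}" for b
    using f by (simp add: analytic_on_holomorphic) blast
  have mpos: "zorder f b > 0" if "b \<in> S" for b
    using zorder_pos_iff'[OF ana eventually_frequently[OF _ ev]] that
    by (simp add: S_def)
  have holA: "f holomorphic_on A" using f holomorphic_on_subset by blast
  obtain h where h: "h holomorphic_on A" "\<And>w. w \<in> A \<Longrightarrow> h w \<noteq> 0" "\<And>w. w \<in> A \<Longrightarrow> f w = h w * Q w"
  proof (rule holomorphic_zorder_factorization[OF holA])
    show "open A" "connected A" by (auto simp: A_def)
    show "Q holomorphic_on A" unfolding Q_def by (intro holomorphic_intros)
    fix w assume w: "w \<in> A"
    show Qz: "(Q w = 0) = (f w = 0)"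
      using finS w mpos by (force simp: Q_def S_def m_def)
    show "zorder Q w = zorder f w"
    proof (cases "f w = 0")
      case True
      then have "w \<in> S" using w by (simp add: S_def)
      define g where "g u = (\<Prod>b\<in>S - {w}. (u - b) ^ m b)" for u
      show ?thesis
      proof (rule zorder_eqI[of UNIV])
        show "g holomorphic_on UNIV" unfolding g_def by (intro holomorphic_intros)
        show "g w \<noteq> 0" using finS by (auto simp: g_def)
        fix u assume "u \<noteq> w"
        have "Q u = (u - w) ^ m w * g u"
          unfolding Q_def g_def by (rule prod.remove[OF finS \<open>w \<in> S\<close>])
        also have "(u - w) ^ m w = (u - w) powi zorder f w"
          using mpos[OF \<open>w \<in> S\<close>] by (simp add: power_int_def m_def)
        finally show "Q u = g u * (u - w) powi zorder f w" by simp
      qed auto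
    next
      case False
      have "Q holomorphic_on UNIV" unfolding Q_def by (intro holomorphic_intros)
      then have "Q analytic_on {w}" by (simp add: analytic_on_holomorphic) blast
      then show ?thesis using zorder_eq_0I ana False Qz by metis
    qed
  qed (blast intro: that)
  have ln: "ln (norm (f w)) = ln (norm (h w)) + (\<Sum>b\<in>S. m b * ln (norm (w - b)))"
    if "w \<in> A" "f w \<noteq> 0" for w
  proof -
    have "w \<noteq> b" if "b \<in> S" for b using that \<open>f w \<noteq> 0\<close> by (auto simp: S_def)
    then have "ln (norm (Q w)) = (\<Sum>b\<in>S. m b * ln (norm (w - b)))"
      unfolding Q_def using finS
      by (subst prod_norm[symmetric], subst ln_prod) (auto simp: norm_power ln_realpow)
    moreover have "h w \<noteq> 0" "Q w \<noteq> 0" using h(2,3)[OF that(1)] that(2) by auto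
    ultimately show ?thesis using h(3)[OF that(1)] by (simp add: norm_mult ln_mult)
  qed
  have circA: "\<zeta> \<in> A" if "norm \<zeta> = R" for \<zeta> using that by (simp add: A_def)
  have neR: "norm b \<noteq> R" if "b \<in> S" for b using that nz by (auto simp: S_def)
  have cont1: "continuous_on (sphere 0 R) (\<lambda>\<zeta>. poisson_kernel R z \<zeta> * ln (norm (h \<zeta>)))"
    using h(2) circA assms
    by (intro continuous_intros continuous_poisson_kernel
        continuous_on_subset[OF holomorphic_on_imp_continuous_on[OF h(1)]]) auto
  have cont2: "continuous_on (sphere 0 R) (\<lambda>\<zeta>. m b * (poisson_kernel R z \<zeta> * ln (norm (\<zeta> - b))))"
    if "b \<in> S" for b
    using neR[OF that] assms
    by (intro continuous_intros continuous_poisson_kernel) auto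
  have "ln (norm (f z)) = ln (norm (h z)) + (\<Sum>b\<in>S. m b * ln (norm (z - b)))"
    by (rule ln) (use assms in \<open>auto simp: A_def\<close>)
  also have "\<dots> \<le> circle_mean R (\<lambda>\<zeta>. poisson_kernel R z \<zeta> * ln (norm (h \<zeta>))) +
      (\<Sum>b\<in>S. m b * circle_mean R (\<lambda>\<zeta>. poisson_kernel R z \<zeta> * ln (norm (\<zeta> - b))))"
  proof (intro add_mono sum_mono mult_left_mono)
    show "ln (norm (h z)) \<le> circle_mean R (\<lambda>\<zeta>. poisson_kernel R z \<zeta> * ln (norm (h \<zeta>)))"
      by (subst poisson_mean_ln_norm[of _ "R + 1"]) (use h assms in \<open>auto simp: A_def\<close>)
    fix b assume b: "b \<in> S"
    then show "ln (norm (z - b)) \<le> circle_mean R (\<lambda>\<zeta>. poisson_kernel R z \<zeta> * ln (norm (\<zeta> - b)))"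
      using assms neR[OF b] by (intro poisson_mean_linear) (auto simp: S_def)
  qed auto
  also have "\<dots> = circle_mean R (\<lambda>\<zeta>. poisson_kernel R z \<zeta> * ln (norm (h \<zeta>)) +
      (\<Sum>b\<in>S. m b * (poisson_kernel R z \<zeta> * ln (norm (\<zeta> - b)))))"
    using cont1 cont2 assms finS
    by (subst circle_mean_add) (auto simp: circle_mean_sum circle_mean_cmult intro!: continuous_on_sum)
  also have "\<dots> = circle_mean R (\<lambda>\<zeta>. poisson_kernel R z \<zeta> * ln (norm (f \<zeta>)))"
    using ln[OF circA nz] assms
    by (intro circle_mean_cong) (auto simp: distrib_left sum_distrib_left mult.left_commute)
  finally show ?thesis .
qed

section \<open>Positive logarithm and proximity function\<close>

lemma log_plus_nonneg [simp]: "0 \<le> log_plus x"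
  by (simp add: log_plus_def)

lemma log_plus_le_iff: "x \<ge> 0 \<Longrightarrow> y \<ge> 0 \<Longrightarrow> log_plus x \<le> y \<longleftrightarrow> x \<le> exp y"
proof -
  assume "x \<ge> 0" "y \<ge> 0"
  have "log_plus x \<le> y \<longleftrightarrow> max 1 x \<le> exp y"
    unfolding log_plus_def by (subst exp_le_cancel_iff[symmetric]) simp
  moreover have "1 \<le> exp y" using \<open>y \<ge> 0\<close> by simp
  ultimately show ?thesis by simp
qed

lemma le_exp_log_plus: "x \<ge> 0 \<Longrightarrow> x \<le> exp (log_plus x)"
  by (simp flip: log_plus_le_iff)

lemma log_plus_mono: "x \<le> y \<Longrightarrow> log_plus x \<le> log_plus y"
  unfolding log_plus_def by (auto simp: max_def)

lemma ln_eq_log_plus: "x > 0 \<Longrightarrow> ln x = log_plus x - log_plus (1 / x)"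
  unfolding log_plus_def by (auto simp: max_def ln_div)

lemma log_plus_mult_le:
  assumes "x \<ge> 0" "y \<ge> 0"
  shows "log_plus (x * y) \<le> log_plus x + log_plus y"
  using mult_mono[OF le_exp_log_plus[OF assms(1)] le_exp_log_plus[OF assms(2)]] assms
  by (subst log_plus_le_iff) (auto simp: exp_add)

lemma log_plus_add_le:
  assumes "x \<ge> 0" "y \<ge> 0"
  shows "log_plus (x + y) \<le> ln 2 + log_plus x + log_plus y"
proof -
  have "exp (log_plus x) \<le> exp (log_plus x + log_plus y)"
    "exp (log_plus y) \<le> exp (log_plus x + log_plus y)" by simp_all
  with le_exp_log_plus[OF assms(1)] le_exp_log_plus[OF assms(2)]
  have "x + y \<le> 2 * exp (log_plus x + log_plus y)" by linarith
  also have "\<dots> = exp (ln 2 + log_plus x + log_plus y)"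
    by (simp add: exp_add)
  finally show ?thesis using assms by (subst log_plus_le_iff) auto
qed

lemma continuous_on_log_plus [continuous_intros]:
  "continuous_on S u \<Longrightarrow> continuous_on S (\<lambda>x. log_plus (u x))"
  unfolding log_plus_def by (intro continuous_intros) auto

lemma proximity_nonneg:
  assumes "f holomorphic_on UNIV" "R \<ge> 0"
  shows "0 \<le> proximity R f"
proof -
  have contf: "continuous_on (sphere 0 R) f"
    by (meson continuous_on_subset assms(1) holomorphic_on_imp_continuous_on subset_UNIV)
  have "circle_mean R (\<lambda>_. 0) \<le> circle_mean R (\<lambda>\<zeta>. log_plus (norm (f \<zeta>)))"
    by (rule circle_mean_mono)
       (use assms(2) in \<open>auto intro!: continuous_on_log_plus continuous_on_norm contf\<close>)
  then show ?thesis unfolding proximity_eq_circle_mean by (simp add: circle_mean_const)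
qed

text \<open>Turns growth in the mean into pointwise growth at half the radius: in the Poisson-Jensen
  inequality the logarithm is replaced by its positive part and the kernel by its upper bound
  3.\<close>

lemma log_plus_le_proximity:
  assumes f: "f holomorphic_on UNIV" and "0 < R" "norm z \<le> R / 2"
    and nz: "\<And>\<zeta>. norm \<zeta> = R \<Longrightarrow> f \<zeta> \<noteq> 0"
  shows "log_plus (norm (f z)) \<le> 3 * proximity R f"
proof -
  have contf: "continuous_on (sphere 0 R) f"
    by (meson continuous_on_subset f holomorphic_on_imp_continuous_on subset_UNIV)
  have nonneg: "0 \<le> proximity R f"
    using f assms(2) by (intro proximity_nonneg) auto
  show ?thesis
  proof (cases "norm (f z) \<le> 1")
    case True
    then show ?thesis using nonneg by (simp add: log_plus_def)
  next
    case False
    have "log_plus (norm (f z)) = ln (norm (f z))" using False by (simp add: log_plus_def)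
    also have "\<dots> \<le> circle_mean R (\<lambda>\<zeta>. poisson_kernel R z \<zeta> * ln (norm (f \<zeta>)))"
      by (rule poisson_jensen) (use assms False in auto)
    also have "\<dots> \<le> circle_mean R (\<lambda>\<zeta>. 3 * log_plus (norm (f \<zeta>)))"
    proof (rule circle_mean_mono)
      show "continuous_on (sphere 0 R) (\<lambda>\<zeta>. poisson_kernel R z \<zeta> * ln (norm (f \<zeta>)))"
        using assms by (intro continuous_intros continuous_poisson_kernel contf) auto
      show "continuous_on (sphere 0 R) (\<lambda>\<zeta>. 3 * log_plus (norm (f \<zeta>)))"
        by (intro continuous_intros contf)
      fix \<zeta> :: complex assume \<zeta>: "norm \<zeta> = R"
      have "poisson_kernel R z \<zeta> * ln (norm (f \<zeta>)) \<le> poisson_kernel R z \<zeta> * log_plus (norm (f \<zeta>))"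
        using ln_eq_log_plus[of "norm (f \<zeta>)"] nz[OF \<zeta>] assms
        by (intro mult_left_mono poisson_kernel_nonneg) auto
      also have "\<dots> \<le> 3 * log_plus (norm (f \<zeta>))"
        using poisson_kernel_bounds[of z R \<zeta>] assms \<zeta> by (intro mult_right_mono) auto
      finally show "poisson_kernel R z \<zeta> * ln (norm (f \<zeta>)) \<le> 3 * log_plus (norm (f \<zeta>))" .
    qed (use assms in auto)
    finally show ?thesis by (simp add: circle_mean_cmult proximity_eq_circle_mean)
  qed
qed

text \<open>Plays the role of the first fundamental theorem for 1/f. In the Poisson-Jensen
  inequality the positive part of ln |f| has weight at most 3 and the negative part weight at least
  1/3; multiplying by 3 gives the constants 9 and 3. The evaluation point is free because f may
  vanish at the origin.\<close>

lemma proximity_inverse_le: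
  assumes f: "f holomorphic_on UNIV" and "0 < R" "norm z \<le> R / 2" "f z \<noteq> 0"
    and nz: "\<And>\<zeta>. norm \<zeta> = R \<Longrightarrow> f \<zeta> \<noteq> 0"
  shows "circle_mean R (\<lambda>\<zeta>. log_plus (1 / norm (f \<zeta>))) \<le> 9 * proximity R f - 3 * ln (norm (f z))"
proof -
  have contf: "continuous_on (sphere 0 R) f"
    by (meson continuous_on_subset f holomorphic_on_imp_continuous_on subset_UNIV)
  have c1: "continuous_on (sphere 0 R) (\<lambda>\<zeta>. 3 * log_plus (norm (f \<zeta>)))"
    by (intro continuous_intros contf)
  have c2: "continuous_on (sphere 0 R) (\<lambda>\<zeta>. (1 / 3) * log_plus (1 / norm (f \<zeta>)))"
    using assms by (intro continuous_intros contf) auto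
  have "ln (norm (f z)) \<le> circle_mean R (\<lambda>\<zeta>. poisson_kernel R z \<zeta> * ln (norm (f \<zeta>)))"
    by (rule poisson_jensen) (use assms in auto)
  also have "\<dots> \<le> circle_mean R (\<lambda>\<zeta>. 3 * log_plus (norm (f \<zeta>)) - (1 / 3) * log_plus (1 / norm (f \<zeta>)))"
  proof (rule circle_mean_mono)
    show "continuous_on (sphere 0 R) (\<lambda>\<zeta>. poisson_kernel R z \<zeta> * ln (norm (f \<zeta>)))"
      using assms by (intro continuous_intros continuous_poisson_kernel contf) auto
    show "continuous_on (sphere 0 R) (\<lambda>\<zeta>. 3 * log_plus (norm (f \<zeta>)) - (1 / 3) * log_plus (1 / norm (f \<zeta>)))"
      by (intro continuous_on_diff c1 c2)
    fix \<zeta> :: complex assume \<zeta>: "norm \<zeta> = R"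
    have "poisson_kernel R z \<zeta> * ln (norm (f \<zeta>)) =
      poisson_kernel R z \<zeta> * log_plus (norm (f \<zeta>)) - poisson_kernel R z \<zeta> * log_plus (1 / norm (f \<zeta>))"
      using ln_eq_log_plus[of "norm (f \<zeta>)"] nz[OF \<zeta>] by (simp add: right_diff_distrib)
    also have "\<dots> \<le> 3 * log_plus (norm (f \<zeta>)) - (1 / 3) * log_plus (1 / norm (f \<zeta>))"
      using poisson_kernel_bounds[of z R \<zeta>] assms \<zeta> by (intro diff_mono mult_right_mono) auto
    finally show "poisson_kernel R z \<zeta> * ln (norm (f \<zeta>)) \<le>
      3 * log_plus (norm (f \<zeta>)) - (1 / 3) * log_plus (1 / norm (f \<zeta>))" .
  qed (use assms in auto)
  also have "\<dots> = 3 * proximity R f - (1 / 3) * circle_mean R (\<lambda>\<zeta>. log_plus (1 / norm (f \<zeta>)))"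
    using c1 c2 assms(2)
    by (subst circle_mean_diff) (auto simp: circle_mean_cmult proximity_eq_circle_mean simp del: times_divide_eq_left)
  finally show ?thesis by simp
qed

text \<open>For \<open>k \<ge> 1\<close> the conjugate of an entire function has no \<open>k\<close>-th Fourier coefficient on a
  circle, so the Taylor coefficients are controlled by the real part alone.\<close>

lemma taylor_coeff_le_proximity_exp:
  assumes P: "P holomorphic_on UNIV" and "R > 0" "k > 0"
  shows "norm ((deriv ^^ k) P 0 / fact k) * R ^ k \<le> 4 * proximity R (\<lambda>z. exp (P z)) - 2 * Re (P 0)"
proof -
  define c where "c = (deriv ^^ k) P 0 / fact k"
  have contP: "continuous_on S P" for S
    by (meson continuous_on_subset P holomorphic_on_imp_continuous_on subset_UNIV)
  have hol: "P holomorphic_on S" for S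
    using P holomorphic_on_subset by blast
  have rn: "norm (rcis R t) = R" for t using assms by simp
  have "((\<lambda>u. P u / (u - 0) ^ Suc k) has_contour_integral (2 * pi * \<i>) / fact k * (deriv ^^ k) P 0)
      (circlepath 0 R)"
    by (rule Cauchy_has_contour_integral_higher_derivative_circlepath) (use contP hol assms in auto)
  then have "((\<lambda>t. P (0 + R * cis t) / (0 + R * cis t - 0) ^ Suc k * R * \<i> * cis t) has_integral
      (2 * pi * \<i>) / fact k * (deriv ^^ k) P 0) {0..2 * pi}"
    unfolding circlepath_def by (subst (asm) has_contour_integral_part_circlepath_iff) auto
  \<comment> \<open>The factor -\<i> R^k turns the Cauchy integral for the k-th derivative into the
    k-th Fourier coefficient of P on the circle.\<close>
  then have "((\<lambda>t. (- \<i> * R ^ k) * (P (0 + R * cis t) / (0 + R * cis t - 0) ^ Suc k * R * \<i> * cis t)) has_integral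
      (- \<i> * R ^ k) * ((2 * pi * \<i>) / fact k * (deriv ^^ k) P 0)) {0..2 * pi}"
    by (rule has_integral_mult_right)
  moreover have "(- \<i> * R ^ k) * ((2 * pi * \<i>) / fact k * (deriv ^^ k) P 0) = 2 * pi * c * R ^ k"
    by (simp add: c_def field_simps)
  moreover have "(- \<i> * R ^ k) * (P (0 + R * cis t) / (0 + R * cis t - 0) ^ Suc k * R * \<i> * cis t) =
      P (rcis R t) * cis (- (k * t))" for t :: real
  proof -
    have "(R * cis t) ^ Suc k = of_real (R ^ k) * cis (k * t) * (R * cis t)"
      by (simp add: power_mult_distrib flip: Complex.DeMoivre)
    moreover have "- \<i> * (u * \<i>) = u" for u by (simp add: algebra_simps)
    ultimately show ?thesis
      using assms by (simp add: rcis_def divide_simps Complex.DeMoivre flip: cis_inverse)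
  qed
  ultimately have I1: "((\<lambda>t. P (rcis R t) * cis (- (k * t))) has_integral 2 * pi * c * R ^ k) {0..2 * pi}"
    by (simp only:)
  \<comment> \<open>The integrand is entire since k > 0; its vanishing integral is the Fourier
    coefficient of index -k of P, so conjugation gives the vanishing k-th coefficient of cnj
    P.\<close>
  have "((\<lambda>u. P u * u ^ (k - 1)) has_contour_integral 0) (circlepath 0 R)"
    by (rule Cauchy_theorem_disc_simple[of _ 0 "R + 1"])
       (use hol assms in \<open>auto intro!: holomorphic_intros\<close>)
  then have "((\<lambda>t. P (0 + R * cis t) * (0 + R * cis t) ^ (k - 1) * R * \<i> * cis t) has_integral 0) {0..2 * pi}"
    unfolding circlepath_def by (subst (asm) has_contour_integral_part_circlepath_iff) auto
  then have "((\<lambda>t. (- \<i> / R ^ k) * (P (0 + R * cis t) * (0 + R * cis t) ^ (k - 1) * R * \<i> * cis t)) has_integral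
      (- \<i> / R ^ k) * 0) {0..2 * pi}"
    by (rule has_integral_mult_right)
  moreover have "(- \<i> / R ^ k) * (P (0 + R * cis t) * (0 + R * cis t) ^ (k - 1) * R * \<i> * cis t) =
      P (rcis R t) * cis (k * t)" for t :: real
  proof -
    have "(R * cis t) ^ (k - 1) * (R * cis t) = (R * cis t) ^ k"
      using assms(3) by (metis power_minus_mult)
    also have "\<dots> = of_real (R ^ k) * cis (k * t)"
      by (simp add: power_mult_distrib Complex.DeMoivre)
    finally have "(R * cis t) ^ (k - 1) * (R * cis t) = of_real (R ^ k) * cis (k * t)" .
    moreover have "(- \<i> / R ^ k) * (P (0 + R * cis t) * (0 + R * cis t) ^ (k - 1) * R * \<i> * cis t) =
      P (R * cis t) / R ^ k * ((R * cis t) ^ (k - 1) * (R * cis t))"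
      by (simp add: algebra_simps)
    ultimately show ?thesis using assms by (simp add: rcis_def)
  qed
  ultimately have "((\<lambda>t. P (rcis R t) * cis (k * t)) has_integral 0) {0..2 * pi}" by simp
  from has_integral_linear[OF this bounded_linear_cnj]
  have I2: "((\<lambda>t. cnj (P (rcis R t)) * cis (- (k * t))) has_integral 0) {0..2 * pi}"
    by (simp add: o_def cis_cnj)
  have I3: "((\<lambda>t. of_real (2 * Re (P (rcis R t))) * cis (- (k * t))) has_integral 2 * pi * c * R ^ k) {0..2 * pi}"
    using has_integral_add[OF I1 I2] by (simp add: complex_add_cnj flip: distrib_right)
  define p where "p \<zeta> = log_plus (norm (exp (P \<zeta>)))" for \<zeta>
  have p: "p \<zeta> = max 0 (Re (P \<zeta>))" for \<zeta>
    by (auto simp: p_def log_plus_def max_def)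
  have contp: "continuous_on S p" for S unfolding p_def by (intro continuous_intros contP)
  have contR: "continuous_on S (\<lambda>\<zeta>. Re (P \<zeta>))" for S by (intro continuous_intros contP)
  have int: "(\<lambda>t. 4 * p (rcis R t) - 2 * Re (P (rcis R t))) integrable_on {0..2 * pi}"
    by (rule circle_integrable) (use assms in \<open>auto intro!: continuous_intros contp contR\<close>)
  \<comment> \<open>With \<open>p\<close> the positive part of Re P, |2 Re P| = 4 p - 2 Re P, and
    the mean of Re P is its value at 0.\<close>
  have "norm (2 * pi * c * R ^ k) \<le> integral {0..2 * pi} (\<lambda>t. 4 * p (rcis R t) - 2 * Re (P (rcis R t)))"
    unfolding integral_unique[OF I3, symmetric]
    by (rule integral_norm_bound_integral[OF has_integral_integrable[OF I3] int])
       (auto simp: norm_mult p)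
  also have "\<dots> = 2 * pi * circle_mean R (\<lambda>\<zeta>. 4 * p \<zeta> - 2 * Re (P \<zeta>))"
    by (simp add: circle_mean_def)
  also have "circle_mean R (\<lambda>\<zeta>. 4 * p \<zeta> - 2 * Re (P \<zeta>)) =
      4 * proximity R (\<lambda>z. exp (P z)) - 2 * circle_mean R (\<lambda>\<zeta>. Re (P \<zeta>))"
    using assms(2) contp contR
    by (subst circle_mean_diff)
       (auto simp: circle_mean_cmult proximity_eq_circle_mean p_def[abs_def] intro!: continuous_intros contP)
  also have "circle_mean R (\<lambda>\<zeta>. Re (P \<zeta>)) = Re (P 0)"
  proof -
    have "circle_mean R (\<lambda>\<zeta>. Re (P \<zeta>)) = circle_mean R (\<lambda>\<zeta>. poisson_kernel R 0 \<zeta> * Re (P \<zeta>))"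
      by (rule circle_mean_cong) (use assms in \<open>auto simp: poisson_kernel_def\<close>)
    also have "\<dots> = Re (P 0)"
      by (rule poisson_mean_Re[of _ "R + 1"]) (use hol assms in auto)
    finally show ?thesis .
  qed
  finally have "2 * pi * (norm c * R ^ k) \<le> 2 * pi * (4 * proximity R (\<lambda>z. exp (P z)) - 2 * Re (P 0))"
    using assms(2) by (simp add: norm_mult norm_power mult.assoc)
  then show ?thesis
    unfolding c_def by (subst (asm) mult_le_cancel_left_pos) auto
qed

section \<open>Quotients of entire functions that are exponentials of polynomials\<close>

text \<open>Pointwise form of finite order, which passes directly to shifts and differences. The
  base 1 + |z| is at least 1, so exponents can be enlarged freely.\<close>

definition finite_growth :: "(complex \<Rightarrow> complex) \<Rightarrow> bool" where
  "finite_growth f \<longleftrightarrow> (\<exists>C K. C \<ge> 0 \<and> (\<forall>z. norm (f z) \<le> exp (C * (1 + norm z) ^ K)))"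

lemma exists_radius_avoiding:
  fixes a b :: real
  assumes "countable Z" "a < b"
  shows "\<exists>R. a < R \<and> R < b \<and> R \<notin> Z"
proof -
  have "uncountable {a<..<b}" using assms(2) by (simp add: uncountable_open_interval)
  then have "\<not> {a<..<b} \<subseteq> Z" using assms(1) countable_subset by blast
  then show ?thesis by auto
qed

lemma countable_zero_radii:
  assumes "f holomorphic_on UNIV" "\<not> f constant_on UNIV"
  shows "countable (norm ` {z::complex. f z = (0::complex)})"
  using holomorphic_countable_zeros[of f UNIV] assms by (auto intro!: countable_image)

lemma nevanlinna_T_entire:
  assumes "f holomorphic_on UNIV"
  shows "nevanlinna_T r f = proximity r f"
proof -
  have "\<not> is_pole f z" for z
    using not_is_pole_holomorphic[of UNIV z f] assms by simp
  then show ?thesis by (simp add: nevanlinna_T_def pole_counting_def pole_count_def)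
qed

lemma growth_order_finite_imp:
  assumes "growth_order f < \<infinity>"
  obtains K :: nat and M where "M \<ge> 1" "\<And>r. r \<ge> M \<Longrightarrow> nevanlinna_T r f \<le> r ^ K"
proof -
  obtain K :: nat where K: "growth_order f < ereal (real K)"
    using assms less_PInf_Ex_of_nat by auto
  have "eventually (\<lambda>r. ereal (log_plus (nevanlinna_T r f) / ln r) < ereal (real K)) at_top"
    using K unfolding growth_order_def by (rule Limsup_lessD)
  then obtain M where M: "\<And>r. r \<ge> M \<Longrightarrow> log_plus (nevanlinna_T r f) / ln r < real K"
    by (auto simp: eventually_at_top_linorder)
  show ?thesis
  proof (rule that)
    show "max M 2 \<ge> 1" by simp
    fix r assume r: "r \<ge> max M 2"
    then have "ln r > 0" by simp
    with M[of r] r have "log_plus (nevanlinna_T r f) < K * ln r" by (simp add: field_simps)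
    then have "ln (max 1 (nevanlinna_T r f)) \<le> ln (r ^ K)"
      using r by (simp add: log_plus_def ln_realpow)
    then have "max 1 (nevanlinna_T r f) \<le> r ^ K" using r by (subst (asm) ln_le_cancel_iff) auto
    then show "nevanlinna_T r f \<le> r ^ K" by simp
  qed
qed

lemma finite_growth_entire:
  assumes f: "f holomorphic_on UNIV" "\<not> f constant_on UNIV" and M: "M \<ge> 1"
    and T: "\<And>r. r \<ge> M \<Longrightarrow> nevanlinna_T r f \<le> r ^ K"
  shows "finite_growth f"
  unfolding finite_growth_def
proof (intro exI conjI allI)
  show "0 \<le> 3 * (2 * M + 3) ^ K" using M by simp
  fix z :: complex
  \<comment> \<open>The radius exceeds 2|z|, as the pointwise bound requires, and M, as the growth
    bound requires; the window of length 1 leaves room to avoid the moduli of zeros.\<close>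
  obtain R where R: "2 * norm z + 2 * M < R" "R < 2 * norm z + 2 * M + 1"
    "R \<notin> norm ` {z. f z = 0}"
    using exists_radius_avoiding[OF countable_zero_radii[OF f], of "2 * norm z + 2 * M" "2 * norm z + 2 * M + 1"]
    by auto
  have Rpos: "0 < R" using R M norm_ge_zero[of z] by linarith
  have RM: "M \<le> R" using R M norm_ge_zero[of z] by linarith
  have "log_plus (norm (f z)) \<le> 3 * proximity R f"
    by (rule log_plus_le_proximity[OF f(1) Rpos]) (use R M in auto)
  also have "\<dots> \<le> 3 * R ^ K"
    using T[OF RM] nevanlinna_T_entire[OF f(1)] by simp
  also have "R ^ K \<le> ((2 * M + 3) * (1 + norm z)) ^ K"
  proof (rule power_mono)
    have "0 \<le> M * norm z" using M by simp
    moreover have "(2 * M + 3) * (1 + norm z) = 2 * M + 3 + 2 * (M * norm z) + 3 * norm z"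
      by (simp add: algebra_simps)
    ultimately show "R \<le> (2 * M + 3) * (1 + norm z)"
      using R M norm_ge_zero[of z] by linarith
  qed (use Rpos in auto)
  finally have "log_plus (norm (f z)) \<le> 3 * (2 * M + 3) ^ K * (1 + norm z) ^ K"
    by (simp add: power_mult_distrib)
  then show "norm (f z) \<le> exp (3 * (2 * M + 3) ^ K * (1 + norm z) ^ K)"
    by (subst (asm) log_plus_le_iff) (use M in auto)
qed

lemma finite_growth_shift:
  assumes "finite_growth f"
  shows "finite_growth (\<lambda>z. f (z + c))"
proof -
  obtain C K where C: "C \<ge> 0" "\<And>z. norm (f z) \<le> exp (C * (1 + norm z) ^ K)"
    using assms by (auto simp: finite_growth_def)
  have "norm (f (z + c)) \<le> exp (C * (1 + norm c) ^ K * (1 + norm z) ^ K)" for z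
  proof -
    have "1 + norm (z + c) \<le> (1 + norm c) * (1 + norm z)"
      using norm_triangle_ineq[of z c] by (simp add: distrib_left distrib_right) (smt (verit) mult_nonneg_nonneg norm_ge_zero)
    then have "(1 + norm (z + c)) ^ K \<le> ((1 + norm c) * (1 + norm z)) ^ K"
      by (intro power_mono) auto
    then have "C * (1 + norm (z + c)) ^ K \<le> C * (1 + norm c) ^ K * (1 + norm z) ^ K"
      using C(1) by (simp add: power_mult_distrib mult_left_mono mult.assoc)
    then show ?thesis using C(2)[of "z + c"] by (meson exp_le_cancel_iff order_trans)
  qed
  then show ?thesis
    unfolding finite_growth_def using C(1) by (intro exI[of _ "C * (1 + norm c) ^ K"] exI[of _ K]) auto
qed

lemma finite_growth_diff:
  assumes "finite_growth f" "finite_growth g"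
  shows "finite_growth (\<lambda>z. f z - g z)"
proof -
  obtain C K where C: "C \<ge> 0" "\<And>z. norm (f z) \<le> exp (C * (1 + norm z) ^ K)"
    using assms(1) by (auto simp: finite_growth_def)
  obtain D L where D: "D \<ge> 0" "\<And>z. norm (g z) \<le> exp (D * (1 + norm z) ^ L)"
    using assms(2) by (auto simp: finite_growth_def)
  have "norm (f z - g z) \<le> exp ((C + D + 1) * (1 + norm z) ^ (K + L))" for z
  proof -
    define X where "X = (1 + norm z) ^ (K + L)"
    have KL: "(1 + norm z) ^ K \<le> X" "(1 + norm z) ^ L \<le> X" "1 \<le> X"
      unfolding X_def by (auto intro!: power_increasing)
    have "C * (1 + norm z) ^ K \<le> (C + D) * X" "D * (1 + norm z) ^ L \<le> (C + D) * X"
      using KL C(1) D(1) by (auto intro!: mult_mono)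
    then have "norm (f z) \<le> exp ((C + D) * X)" "norm (g z) \<le> exp ((C + D) * X)"
      using C(2)[of z] D(2)[of z] by (meson exp_le_cancel_iff order_trans)+
    then have "norm (f z - g z) \<le> 2 * exp ((C + D) * X)"
      using norm_triangle_ineq4[of "f z" "g z"] by linarith
    also have "\<dots> \<le> exp X * exp ((C + D) * X)"
      using KL(3) order_trans[OF _ exp_ge_add_one_self[of X], of 2] by (intro mult_right_mono) auto
    also have "\<dots> = exp ((C + D + 1) * X)" by (simp add: algebra_simps flip: exp_add)
    finally show ?thesis unfolding X_def .
  qed
  then show ?thesis
    unfolding finite_growth_def using C(1) D(1) by (intro exI[of _ "C + D + 1"] exI[of _ "K + L"]) auto
qed

section \<open>Mean growth and admissible radii\<close>

lemma proximity_le_of_finite_growth: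
  assumes "finite_growth f" "f holomorphic_on UNIV"
  obtains B K where "B \<ge> 0" "\<And>R. R \<ge> 1 \<Longrightarrow> proximity R f \<le> B * R ^ K"
proof -
  obtain C K where C: "C \<ge> 0" "\<And>z. norm (f z) \<le> exp (C * (1 + norm z) ^ K)"
    using assms(1) by (auto simp: finite_growth_def)
  have contf: "continuous_on S f" for S
    by (meson continuous_on_subset assms(2) holomorphic_on_imp_continuous_on subset_UNIV)
  show ?thesis
  proof (rule that)
    show "C * 2 ^ K \<ge> 0" using C by simp
    fix R :: real assume R: "R \<ge> 1"
    have "proximity R f \<le> circle_mean R (\<lambda>_. C * 2 ^ K * R ^ K)"
      unfolding proximity_eq_circle_mean
    proof (rule circle_mean_mono)
      show "continuous_on (sphere 0 R) (\<lambda>\<zeta>. log_plus (norm (f \<zeta>)))"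
        by (intro continuous_intros contf)
      fix \<zeta> :: complex assume \<zeta>: "norm \<zeta> = R"
      have "(1 + R) ^ K \<le> (2 * R) ^ K" using R by (intro power_mono) auto
      then have "C * (1 + R) ^ K \<le> C * 2 ^ K * R ^ K"
        using C(1) by (simp add: power_mult_distrib mult_left_mono mult.assoc)
      then have "norm (f \<zeta>) \<le> exp (C * 2 ^ K * R ^ K)"
        using C(2)[of \<zeta>] \<zeta> by (metis exp_le_cancel_iff order_trans)
      then show "log_plus (norm (f \<zeta>)) \<le> C * 2 ^ K * R ^ K"
        using C(1) R by (subst log_plus_le_iff) auto
    qed (use R in auto)
    then show "proximity R f \<le> C * 2 ^ K * R ^ K" by (simp add: circle_mean_const)
  qed
qed

lemma proximity_diff_le:
  assumes "f holomorphic_on UNIV" "g holomorphic_on UNIV" "R \<ge> 0"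
  shows "proximity R (\<lambda>z. f z - g z) \<le> ln 2 + proximity R f + proximity R g"
proof -
  have contf: "continuous_on S f" "continuous_on S g" for S
    by (meson continuous_on_subset assms holomorphic_on_imp_continuous_on subset_UNIV)+
  have "proximity R (\<lambda>z. f z - g z) \<le>
      circle_mean R (\<lambda>\<zeta>. (ln 2 + log_plus (norm (f \<zeta>))) + log_plus (norm (g \<zeta>)))"
    unfolding proximity_eq_circle_mean
  proof (rule circle_mean_mono)
    fix \<zeta>
    have "log_plus (norm (f \<zeta> - g \<zeta>)) \<le> log_plus (norm (f \<zeta>) + norm (g \<zeta>))"
      by (intro log_plus_mono norm_triangle_ineq4)
    then show "log_plus (norm (f \<zeta> - g \<zeta>)) \<le> ln 2 + log_plus (norm (f \<zeta>)) + log_plus (norm (g \<zeta>))"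
      using log_plus_add_le[of "norm (f \<zeta>)" "norm (g \<zeta>)"] by simp
  qed (use assms in \<open>auto intro!: continuous_on_log_plus continuous_on_norm continuous_on_add
         continuous_on_diff continuous_on_const contf\<close>)
  also have "\<dots> = ln 2 + proximity R f + proximity R g"
    using assms(3) contf unfolding proximity_eq_circle_mean
    by (simp add: circle_mean_add circle_mean_const continuous_on_log_plus continuous_on_norm
        continuous_on_add)
  finally show ?thesis .
qed

text \<open>Otherwise E would contain almost all of a half-line, on which 1/r has infinite integral:
  up to \<open>N\<close> it is \<open>ln N - ln M'\<close>, and
  \<open>N = exp (ln M' + x + 1)\<close> already exceeds the assumed total x.\<close>

lemma finite_log_measure_avoid:
  fixes M :: real
  assumes "finite_log_measure E" "countable Z"
  shows "\<exists>R>M. R \<notin> E \<and> R \<notin> Z"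
proof (rule ccontr)
  assume "\<not> ?thesis"
  then have sub: "R \<in> E \<or> R \<in> Z" if "R > M" for R using that by auto
  define M' where "M' = max M 1"
  have M': "M' \<ge> 1" "M' \<ge> M" by (auto simp: M'_def)
  define I where "I = (\<integral>\<^sup>+r\<in>E. ennreal (1 / r) \<partial>lebesgue)"
  have "I < \<infinity>" using assms(1) by (simp add: finite_log_measure_def I_def)
  then obtain x where x: "I = ennreal x" "x \<ge> 0" by (cases I) auto
  have "ennreal (ln N - ln M') \<le> I" if N: "N \<ge> M'" for N
  proof -
    have "ennreal (ln N - ln M') = (\<integral>\<^sup>+r. ennreal (1 / r) * indicator {M'..N} r \<partial>lborel)"
      using N M' by (subst nn_integral_FTC_Icc[of _ _ _ ln])
        (auto intro!: DERIV_ln_divide simp flip: has_real_derivative_iff_has_vector_derivative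
              intro: has_field_derivative_at_within)
    also have "\<dots> = (\<integral>\<^sup>+r. ennreal (1 / r) * indicator {M'..N} r \<partial>lebesgue)"
      by (subst nn_integral_completion) auto
    also have "\<dots> \<le> I"
      unfolding I_def
    proof (rule nn_integral_mono_AE)
      have "countable (Z \<union> {M'})" using assms(2) by simp
      then have "AE r in lborel. r \<notin> Z \<union> {M'}"
        by (intro AE_not_in countable_imp_null_set_lborel)
      then have "AE r in lebesgue. r \<notin> Z \<union> {M'}" by (rule AE_completion)
      then show "AE r in lebesgue. ennreal (1 / r) * indicator {M'..N} r \<le> ennreal (1 / r) * indicator E r"
      proof (eventually_elim)
        case (elim r)
        then show ?case using sub[of r] M' by (auto split: split_indicator)
      qed
    qed
    finally show ?thesis .
  qed
  moreover have "M' \<le> exp (ln M' + x + 1)"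
    using M' x by (subst ln_le_cancel_iff[symmetric]) auto
  ultimately have "ennreal (ln (exp (ln M' + x + 1)) - ln M') \<le> I" by blast
  then have "ennreal (x + 1) \<le> ennreal x" unfolding ln_exp x(1) by (simp add: add.commute)
  then show False using x by simp
qed

text \<open>The little-o relation, taken with constant 1, holds for all large radii outside the
  exceptional set, and such radii are unbounded even after removing Z.\<close>

lemma small_function_radii:
  fixes M :: real
  assumes "a \<in> small_functions f" "countable Z"
  shows "\<exists>R>M. R \<notin> Z \<and> \<bar>nevanlinna_T R a\<bar> \<le> \<bar>nevanlinna_T R f\<bar>"
proof -
  obtain E where E: "finite_log_measure E"
    "(\<lambda>r. nevanlinna_T r a) \<in> o[inf at_top (principal (- E))](\<lambda>r. nevanlinna_T r f)"
    using assms(1) by (auto simp: small_functions_def is_S_def)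
  have "eventually (\<lambda>r. norm (nevanlinna_T r a) \<le> 1 * norm (nevanlinna_T r f)) (inf at_top (principal (- E)))"
    by (rule landau_o.smallD[OF E(2)]) simp
  then have "eventually (\<lambda>r. r \<notin> E \<longrightarrow> \<bar>nevanlinna_T r a\<bar> \<le> \<bar>nevanlinna_T r f\<bar>) at_top"
    by (simp add: eventually_inf_principal)
  then obtain M0 where M0: "\<And>r. r \<ge> M0 \<Longrightarrow> r \<notin> E \<Longrightarrow> \<bar>nevanlinna_T r a\<bar> \<le> \<bar>nevanlinna_T r f\<bar>"
    by (auto simp: eventually_at_top_linorder)
  obtain R where "R > max M M0" "R \<notin> E" "R \<notin> Z"
    using finite_log_measure_avoid[OF E(1) assms(2)] by blast
  then show ?thesis using M0[of R] by auto
qed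

text \<open>The proximity function of exp P is at most that of N plus that of 1/g, and
  \<open>proximity_inverse_le\<close> bounds the latter by that of g. Hence it is O(R^K) on an
  unbounded set of radii, and \<open>taylor_coeff_le_proximity_exp\<close> removes every Taylor
  coefficient of P above K.\<close>

lemma exp_quotient_polynomial:
  assumes P: "P holomorphic_on UNIV" and g: "g holomorphic_on UNIV" and N: "N holomorphic_on UNIV"
    and eq: "\<And>z. N z = exp (P z) * g z" and g0: "g z0 \<noteq> 0"
    and radii: "\<And>M. \<exists>R>M. (\<forall>\<zeta>. norm \<zeta> = R \<longrightarrow> g \<zeta> \<noteq> 0) \<and>
        proximity R g \<le> B * R ^ K \<and> proximity R N \<le> B * R ^ K"
    and "B \<ge> 0"
  shows "\<exists>p. P = poly p"
proof -
  define c where "c k = (deriv ^^ k) P 0 / fact k" for k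
  \<comment> \<open>The constants arise as 40 = 4 (1 + 9) and 12 = 4 * 3, from the Taylor bound with
    factor 4 applied to the bounds for N and 1/g.\<close>
  define D where "D = 40 * B + \<bar>12 * ln (norm (g z0)) + 2 * Re (P 0)\<bar>"
  have contf: "continuous_on S g" "continuous_on S N" "continuous_on S P" for S
    by (meson continuous_on_subset g N P holomorphic_on_imp_continuous_on subset_UNIV)+
  have c0: "c k = 0" if k: "k > K" for k
  proof (rule ccontr)
    assume ck: "c k \<noteq> 0"
    obtain R where R: "R > max (max 1 (2 * norm z0)) (D / norm (c k))"
      "\<And>\<zeta>. norm \<zeta> = R \<Longrightarrow> g \<zeta> \<noteq> 0" "proximity R g \<le> B * R ^ K" "proximity R N \<le> B * R ^ K"
      using radii by blast
    have R1: "R > 1" "norm z0 \<le> R / 2" "D < R * norm (c k)" using R(1) ck by (auto simp: field_simps)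
    have "proximity R (\<lambda>z. exp (P z)) \<le>
        circle_mean R (\<lambda>\<zeta>. log_plus (norm (N \<zeta>)) + log_plus (1 / norm (g \<zeta>)))"
      unfolding proximity_eq_circle_mean
    proof (rule circle_mean_mono)
      show "continuous_on (sphere 0 R) (\<lambda>\<zeta>. log_plus (norm (exp (P \<zeta>))))"
        by (intro continuous_intros contf)
      show "continuous_on (sphere 0 R) (\<lambda>\<zeta>. log_plus (norm (N \<zeta>)) + log_plus (1 / norm (g \<zeta>)))"
        using R(2) by (intro continuous_intros contf) auto
      fix \<zeta> :: complex assume "norm \<zeta> = R"
      then have "g \<zeta> \<noteq> 0" using R(2) by auto
      then have "norm (exp (P \<zeta>)) = norm (N \<zeta>) * (1 / norm (g \<zeta>))"
        unfolding eq by (simp add: norm_mult)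
      then show "log_plus (norm (exp (P \<zeta>))) \<le> log_plus (norm (N \<zeta>)) + log_plus (1 / norm (g \<zeta>))"
        by (metis log_plus_mult_le norm_ge_zero zero_le_divide_1_iff)
    qed (use R1 in auto)
    also have "\<dots> = proximity R N + circle_mean R (\<lambda>\<zeta>. log_plus (1 / norm (g \<zeta>)))"
      unfolding proximity_eq_circle_mean using R(2) R1
      by (intro circle_mean_add continuous_intros contf) auto
    also have "\<dots> \<le> B * R ^ K + (9 * (B * R ^ K) - 3 * ln (norm (g z0)))"
      using proximity_inverse_le[OF g _ R1(2) g0 R(2)] R1 R(3,4) by auto
    finally have "4 * proximity R (\<lambda>z. exp (P z)) - 2 * Re (P 0) \<le>
        40 * B * R ^ K + \<bar>12 * ln (norm (g z0)) + 2 * Re (P 0)\<bar>" by simp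
    also have "\<dots> \<le> 40 * B * R ^ K + \<bar>12 * ln (norm (g z0)) + 2 * Re (P 0)\<bar> * R ^ K"
      using R1 by (simp add: mult_left_le one_le_power mult_le_cancel_left1)
    also have "\<dots> = D * R ^ K" by (simp add: D_def algebra_simps)
    finally have "norm (c k) * R ^ k \<le> D * R ^ K"
      using taylor_coeff_le_proximity_exp[OF P, of R k] k R1 by (simp add: c_def)
    moreover have "R * R ^ K \<le> R ^ k"
      using R1 k by (simp flip: power_Suc add: power_increasing)
    then have "norm (c k) * (R * R ^ K) \<le> norm (c k) * R ^ k"
      by (intro mult_left_mono) auto
    ultimately have "(R * norm (c k)) * R ^ K \<le> D * R ^ K" by (simp add: mult_ac)
    then have "R * norm (c k) \<le> D" using R1 by (subst (asm) mult_le_cancel_right) auto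
    then show False using R1 by simp
  qed
  define p where "p = (\<Sum>k\<le>K. monom (c k) k)"
  have "P w = poly p w" for w
  proof -
    have "(\<lambda>k. (deriv ^^ k) P 0 / fact k * (w - 0) ^ k) sums P w"
      by (rule holomorphic_power_series[of _ _ "norm w + 1"])
         (use P holomorphic_on_subset in auto)
    then have "(\<lambda>k. c k * w ^ k) sums P w" by (simp add: c_def)
    moreover have "(\<lambda>k. c k * w ^ k) sums (\<Sum>k\<le>K. c k * w ^ k)"
      by (rule sums_finite) (use c0 in auto)
    ultimately have "P w = (\<Sum>k\<le>K. c k * w ^ k)" by (rule sums_unique2)
    then show ?thesis by (simp add: p_def poly_sum poly_monom)
  qed
  then show ?thesis by blast
qed

section \<open>Forward differences\<close>

text \<open>Differences are taken of sequences along an orbit, with the index kept separate from the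
  point z, so that z can go to infinity while the index stays fixed.\<close>

primrec fdiff :: "nat \<Rightarrow> (nat \<Rightarrow> complex) \<Rightarrow> nat \<Rightarrow> complex" where
  "fdiff 0 x j = x j"
| "fdiff (Suc n) x j = fdiff n x (Suc j) - fdiff n x j"

lemma fdiff_shift: "fdiff n x (j + i) = fdiff n (\<lambda>k. x (k + i)) j"
  by (induction n arbitrary: j) (simp_all flip: add_Suc)

lemma fdiff_cong: "(\<And>k. j \<le> k \<Longrightarrow> k \<le> j + n \<Longrightarrow> x k = y k) \<Longrightarrow> fdiff n x j = fdiff n y j"
  by (induction n arbitrary: j) auto

lemma fdiff_mult_left: "fdiff n (\<lambda>k. a * x k) j = a * fdiff n x j"
  by (induction n arbitrary: j) (auto simp: right_diff_distrib)

lemma fdiff_add: "fdiff n (\<lambda>k. x k + y k) j = fdiff n x j + fdiff n y j"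
  by (induction n arbitrary: j) auto

lemma fdiff_diff: "fdiff n (\<lambda>k. x k - y k) j = fdiff n x j - fdiff n y j"
  by (induction n arbitrary: j) auto

lemma fdiff_const: "n > 0 \<Longrightarrow> fdiff n (\<lambda>k. a) j = 0"
proof (induction n arbitrary: j)
  case (Suc n)
  then show ?case by (cases n) auto
qed simp

lemma fdiff_power: "fdiff n (\<lambda>k. \<mu> ^ k) j = (\<mu> - 1) ^ n * \<mu> ^ j"
  by (induction n arbitrary: j) (auto simp: algebra_simps)

text \<open>The binomial expansion of an n-th difference has extreme coefficients 1 and (-1)^n.
  \<open>fdiff_top\<close> and \<open>fdiff_bot\<close> read them off when one end of the window is
  the only nonzero entry.\<close>

lemma fdiff_top: "(\<And>k. j \<le> k \<Longrightarrow> k < j + n \<Longrightarrow> x k = 0) \<Longrightarrow> fdiff n x j = x (j + n)"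
proof (induction n arbitrary: j)
  case (Suc n)
  have "fdiff n x (Suc j) = x (Suc j + n)" by (rule Suc.IH) (use Suc.prems in auto)
  moreover have "fdiff n x j = x (j + n)" by (rule Suc.IH) (use Suc.prems in auto)
  ultimately show ?case using Suc.prems[of "j + n"] by simp
qed simp

lemma fdiff_bot: "(\<And>k. j < k \<Longrightarrow> x k = 0) \<Longrightarrow> fdiff n x j = (-1) ^ n * x j"
proof (induction n arbitrary: j)
  case (Suc n)
  have "fdiff n x (Suc j) = (-1) ^ n * x (Suc j)" by (rule Suc.IH) (use Suc.prems in auto)
  moreover have "fdiff n x j = (-1) ^ n * x j" by (rule Suc.IH) (use Suc.prems in auto)
  ultimately show ?case using Suc.prems[of "Suc j"] by simp
qed simp

lemma tendsto_fdiff: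
  assumes "\<And>k. j \<le> k \<Longrightarrow> k \<le> j + n \<Longrightarrow> ((\<lambda>r. x r k) \<longlongrightarrow> y k) F"
  shows "((\<lambda>r. fdiff n (x r) j) \<longlongrightarrow> fdiff n y j) F"
  using assms by (induction n arbitrary: j) (auto intro!: tendsto_diff)

section \<open>Iterated differences and the exponential quotients from sharing\<close>

lemma funpow_difference_Suc:
  "(difference c ^^ Suc n) f z = (difference c ^^ n) f (z + c) - (difference c ^^ n) f z"
proof -
  have "(difference c ^^ Suc n) f = difference c ((difference c ^^ n) f)" by simp
  then show ?thesis by (simp only: difference_def[of c "(difference c ^^ n) f"])
qed

lemma funpow_difference:
  "(difference c ^^ n) f z = fdiff n (\<lambda>k. f (z + of_nat k * c)) 0"
proof (induction n arbitrary: z)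
  case (Suc n)
  have "fdiff n (\<lambda>k. f (z + of_nat k * c)) (0 + 1) = fdiff n (\<lambda>k. f (z + c + of_nat k * c)) 0"
    unfolding fdiff_shift by (simp add: algebra_simps)
  then show ?case unfolding funpow_difference_Suc by (simp add: Suc)
qed simp

lemma holomorphic_funpow_difference:
  assumes "f holomorphic_on UNIV"
  shows "(difference c ^^ n) f holomorphic_on UNIV"
proof (induction n)
  case (Suc n)
  have "(\<lambda>z. (difference c ^^ n) f (z + c)) holomorphic_on UNIV"
    using holomorphic_on_compose_gen[of "\<lambda>z. z + c" UNIV "(difference c ^^ n) f" UNIV] Suc
    by (simp add: o_def holomorphic_on_add)
  then have "difference c ((difference c ^^ n) f) holomorphic_on UNIV"
    unfolding difference_def[of c "(difference c ^^ n) f"] using Suc by (rule holomorphic_on_diff)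
  then show ?case by simp
qed (use assms in auto)

lemma finite_growth_funpow_difference:
  assumes "finite_growth f"
  shows "finite_growth ((difference c ^^ n) f)"
proof (induction n)
  case (Suc n)
  then have "finite_growth (difference c ((difference c ^^ n) f))"
    unfolding difference_def[of c "(difference c ^^ n) f"]
    by (intro finite_growth_diff finite_growth_shift)
  then show ?case by simp
qed (use assms in simp)

text \<open>The quotient extends to a zero-free entire function, which has a logarithm because the
  plane is contractible.\<close>

lemma zeros_eq_imp_exp_quotient:
  assumes A: "A holomorphic_on UNIV" and B: "B holomorphic_on UNIV"
    and zero: "\<And>z. A z = 0 \<longleftrightarrow> B z = 0"
    and ord: "\<And>z. A z = 0 \<Longrightarrow> zorder A z = zorder B z"
  obtains P where "P holomorphic_on UNIV" "\<And>z. A z = exp (P z) * B z"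
proof -
  have ana: "A analytic_on {z}" "B analytic_on {z}" for z
    using A B by (simp_all add: analytic_on_holomorphic) blast+
  \<comment> \<open>The hypothesis compares orders at zeros; elsewhere both orders are 0.\<close>
  have "zorder B z = zorder A z" for z
    using ord[of z] zero[of z] zorder_eq_0I[OF ana(1)[of z]] zorder_eq_0I[OF ana(2)[of z]]
    by (cases "A z = 0") auto
  then obtain h where h: "h holomorphic_on UNIV" "\<And>z. h z \<noteq> 0" "\<And>z. A z = h z * B z"
    using holomorphic_zorder_factorization[OF A open_UNIV connected_UNIV B] zero by auto
  obtain P where "P holomorphic_on UNIV" "\<And>z. h z = exp (P z)"
    using contractible_imp_holomorphic_log[OF h(1)] h(2) by auto
  with h(3) that show ?thesis by auto
qed

lemma periodic_of_nat:
  fixes a :: "complex \<Rightarrow> 'a"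
  assumes "\<And>z. a (z + c) = a z"
  shows "a (z + of_nat k * c) = a z"
proof (induction k)
  case (Suc k)
  have "a (z + of_nat (Suc k) * c) = a ((z + of_nat k * c) + c)" by (simp add: algebra_simps)
  with Suc show ?case by (simp add: assms)
qed simp

lemma share_CM_exp_polynomials:
  fixes c :: complex and n :: nat and f a :: "complex \<Rightarrow> complex"
  assumes n: "n \<ge> 1"
    and f: "f holomorphic_on UNIV" "\<not> f constant_on UNIV" "growth_order f < \<infinity>"
    and nz: "(difference c ^^ n) f \<noteq> (\<lambda>z. 0)"
    and a: "a holomorphic_on UNIV" "a \<in> small_functions f" "\<And>z. a (z + c) = a z"
    and share: "share_CM a {f, (difference c ^^ n) f, (difference c ^^ (n + 1)) f}"
  obtains p d where
    "\<And>z. (difference c ^^ n) f z - a z = exp (poly p z) * (f z - a z)"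
    "\<And>z. (difference c ^^ (n + 1)) f z - a z = exp (poly d z) * ((difference c ^^ n) f z - a z)"
proof -
  define g where "g z = f z - a z" for z
  define F where "F m = (difference c ^^ m) f" for m
  define N where "N m z = F m z - a z" for m z
  have holF: "F m holomorphic_on UNIV" for m
    unfolding F_def by (rule holomorphic_funpow_difference[OF f(1)])
  have hol: "g holomorphic_on UNIV" "N m holomorphic_on UNIV" for m
    unfolding g_def[abs_def] N_def[abs_def] using f a holF by (auto intro!: holomorphic_intros)
  note aper = periodic_of_nat[of a, OF a(3)]
  \<comment> \<open>If f were \<open>a\<close>, its n-th difference would vanish by
    periodicity.\<close>
  have gnz: "\<exists>z. g z \<noteq> 0"
  proof (rule ccontr)
    assume "\<not> ?thesis"
    then have "f = a" by (auto simp: g_def)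
    then have "(difference c ^^ n) f = (\<lambda>z. 0)"
      using n by (intro ext) (simp add: funpow_difference aper fdiff_const)
    with nz show False by simp
  qed
  have share': "(u z - a z = 0 \<longleftrightarrow> h z - a z = 0) \<and>
      (u z - a z = 0 \<longrightarrow> zorder (\<lambda>w. u w - a w) z = zorder (\<lambda>w. h w - a w) z)"
    if "u \<in> {f, F n, F (n + 1)}" "h \<in> {f, F n, F (n + 1)}" for u h z
    using share that unfolding share_CM_def F_def by blast
  have N0: "N n z = 0 \<longleftrightarrow> g z = 0" "N (n + 1) z = 0 \<longleftrightarrow> g z = 0"
    "N n z = 0 \<Longrightarrow> zorder (N n) z = zorder g z"
    "N (n + 1) z = 0 \<Longrightarrow> zorder (N (n + 1)) z = zorder (N n) z" for z
    using share'[of "F n" f z] share'[of "F (n + 1)" f z] share'[of "F (n + 1)" "F n" z]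
    unfolding g_def[abs_def] N_def[abs_def] by blast+
  obtain P where P: "P holomorphic_on UNIV" "\<And>z. N n z = exp (P z) * g z"
    by (rule zeros_eq_imp_exp_quotient[OF hol(2)[of n] hol(1)]) (use N0 in auto)
  obtain D where D: "D holomorphic_on UNIV" "\<And>z. N (n + 1) z = exp (D z) * N n z"
    by (rule zeros_eq_imp_exp_quotient[OF hol(2)[of "n + 1"] hol(2)[of n]]) (use N0 in auto)
  \<comment> \<open>Both quotients are taken over \<open>g\<close>, so the same radii and the same
    point \<open>z0\<close> serve for P and for P + D; D is recovered by subtraction.\<close>
  have ED: "N (n + 1) z = exp (P z + D z) * g z" for z
    unfolding D(2) P(2) by (simp add: exp_add)
  obtain K M where KM: "M \<ge> 1" "\<And>r. r \<ge> M \<Longrightarrow> nevanlinna_T r f \<le> r ^ K"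
    using growth_order_finite_imp[OF f(3)] by blast
  have fg: "finite_growth (F m)" for m
    unfolding F_def by (intro finite_growth_funpow_difference finite_growth_entire[OF f(1,2) KM])
  obtain B1 K1 where 1: "B1 \<ge> 0" "\<And>R. R \<ge> 1 \<Longrightarrow> proximity R (F n) \<le> B1 * R ^ K1"
    using proximity_le_of_finite_growth[OF fg holF] by blast
  obtain B2 K2 where 2: "B2 \<ge> 0" "\<And>R. R \<ge> 1 \<Longrightarrow> proximity R (F (n + 1)) \<le> B2 * R ^ K2"
    using proximity_le_of_finite_growth[OF fg holF] by blast
  \<comment> \<open>The 3 absorbs \<open>ln 2\<close> and the bounds R^K for the proximity functions
    of f and \<open>a\<close>.\<close>
  define B where "B = 3 + B1 + B2"
  define L where "L = K + K1 + K2"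
  obtain z0 where z0: "g z0 \<noteq> 0" using gnz by blast
  have "countable (norm ` {z. g z = 0})"
  proof (cases "g constant_on UNIV")
    case True
    then have "{z. g z = 0} = {}" using z0 by (auto simp: constant_on_def)
    then show ?thesis by simp
  qed (rule countable_zero_radii[OF hol(1)])
  note cZ = this
  have radii: "\<exists>R>M0. (\<forall>\<zeta>. norm \<zeta> = R \<longrightarrow> g \<zeta> \<noteq> 0) \<and> proximity R g \<le> B * R ^ L \<and>
      proximity R (N n) \<le> B * R ^ L \<and> proximity R (N (n + 1)) \<le> B * R ^ L" for M0
  proof -
    obtain R where R: "R > max M M0" "R \<notin> norm ` {z. g z = 0}"
      "\<bar>nevanlinna_T R a\<bar> \<le> \<bar>nevanlinna_T R f\<bar>"
      using small_function_radii[OF a(2) cZ] by blast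
    have R1: "R \<ge> 1" "R \<ge> M" using R KM by auto
    have pf: "proximity R f \<le> R ^ K" using KM(2)[OF R1(2)] nevanlinna_T_entire[OF f(1)] by simp
    have pa: "proximity R a \<le> R ^ K"
      using R(3) pf proximity_nonneg[OF f(1), of R] proximity_nonneg[OF a(1), of R] R1
      unfolding nevanlinna_T_entire[OF f(1)] nevanlinna_T_entire[OF a(1)] by simp
    have KL: "R ^ K \<le> R ^ L" "R ^ K1 \<le> R ^ L" "R ^ K2 \<le> R ^ L" "1 \<le> R ^ L"
      using R1 by (auto simp: L_def intro!: power_increasing)
    have l2: "ln 2 \<le> R ^ L" using ln_2_less_1 KL(4) by linarith
    have t: "B1 * R ^ K1 \<le> B1 * R ^ L" "B2 * R ^ K2 \<le> B2 * R ^ L"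
      using 1(1) 2(1) KL by (auto intro!: mult_left_mono)
    have nn: "0 \<le> B1 * R ^ L" "0 \<le> B2 * R ^ L" using 1(1) 2(1) R1 by auto
    have BL: "B * R ^ L = 3 * R ^ L + B1 * R ^ L + B2 * R ^ L" by (simp add: B_def algebra_simps)
    have "proximity R g \<le> B * R ^ L"
      using proximity_diff_le[OF f(1) a(1), of R] pf pa KL l2 R1 t nn unfolding g_def[abs_def] BL
      by linarith
    moreover have "proximity R (N n) \<le> B * R ^ L"
      using proximity_diff_le[OF holF[of n] a(1), of R] 1(2)[of R] pa KL l2 R1 t nn
      unfolding N_def[abs_def] BL by linarith
    moreover have "proximity R (N (n + 1)) \<le> B * R ^ L"
      using proximity_diff_le[OF holF[of "n + 1"] a(1), of R] 2(2)[of R] pa KL l2 R1 t nn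
      unfolding N_def[abs_def] BL by linarith
    ultimately show ?thesis using R by (intro exI[of _ R]) auto
  qed
  have "B \<ge> 0" using 1 2 by (simp add: B_def)
  have "\<exists>p. P = poly p"
    by (rule exp_quotient_polynomial[OF P(1) hol(1) hol(2)[of n] P(2) z0 _ \<open>B \<ge> 0\<close>, of L])
       (use radii in blast)
  then obtain p where p: "P = poly p" by blast
  have holPD: "(\<lambda>z. P z + D z) holomorphic_on UNIV"
    using P(1) D(1) by (rule holomorphic_on_add)
  have "\<exists>q. (\<lambda>z. P z + D z) = poly q"
    by (rule exp_quotient_polynomial[OF holPD hol(1) hol(2)[of "n + 1"] ED z0 _ \<open>B \<ge> 0\<close>, of L])
       (use radii in blast)
  then obtain q where q: "\<And>z. P z + D z = poly q z" by metis
  have "D z = poly (q - p) z" for z using q[of z] p by (simp add: algebra_simps)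
  then show ?thesis
    using that[of p "q - p"] P(2) D(2) p by (auto simp: N_def F_def g_def)
qed

section \<open>Limits along rays\<close>

text \<open>The inhomogeneous part of the solution of \<open>s (Suc k) = 1 + x k * s k\<close>, that
  is, the solution started at 0.\<close>

primrec affine_const :: "(nat \<Rightarrow> complex) \<Rightarrow> nat \<Rightarrow> complex" where
  "affine_const x 0 = 0"
| "affine_const x (Suc k) = 1 + x k * affine_const x k"

lemma affine_recurrence:
  assumes "\<And>k. s (Suc k) = 1 + x k * s k"
  shows "s (j + k) = affine_const (\<lambda>i. x (j + i)) k + (\<Prod>i<k. x (j + i)) * s j"
  by (induction k) (auto simp: assms algebra_simps)

lemma tendsto_affine_const:
  assumes "\<And>i. ((\<lambda>r. x r i) \<longlongrightarrow> y i) F"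
  shows "((\<lambda>r. affine_const (x r) k) \<longlongrightarrow> affine_const y k) F"
  by (induction k) (auto intro!: tendsto_intros assms)

text \<open>The recurrence determines \<open>s (j + k)\<close> as an affine function of \<open>s j\<close>. After division by
  \<open>q\<close> the difference equation becomes a linear equation for \<open>s j\<close> whose coefficients converge
  to limits that do not depend on \<open>j\<close>.\<close>

lemma recurrence_limit:
  fixes R V W :: "real \<Rightarrow> nat \<Rightarrow> complex"
  assumes rec: "\<And>k r. r > 0 \<Longrightarrow> R r (Suc k) = 1 + (1 + W r k) * R r k"
    and eqn: "\<And>j r. r > 0 \<Longrightarrow> fdiff n (\<lambda>k. V r k * R r k) j = 1 + R r j"
    and W: "\<And>k. ((\<lambda>r. W r k) \<longlongrightarrow> \<omega>) at_top"
    and V: "\<And>j k. k \<le> n \<Longrightarrow> ((\<lambda>r. V r (j + k) / q r j) \<longlongrightarrow> \<xi> k) at_top"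
    and q: "\<And>j. ((\<lambda>r. 1 / q r j) \<longlongrightarrow> \<epsilon>) at_top" "\<And>j r. q r j \<noteq> 0"
    and ne: "fdiff n (\<lambda>k. \<xi> k * (1 + \<omega>) ^ k) 0 \<noteq> \<epsilon>"
  shows "\<exists>L. L = 1 + (1 + \<omega>) * L \<and> L * fdiff n \<xi> 0 = \<epsilon> * (1 + L)"
proof -
  define A where "A r j k = affine_const (\<lambda>i. 1 + W r (j + i)) k" for r j k
  define B where "B r j k = (\<Prod>i<k. 1 + W r (j + i))" for r j k
  define X where "X r j = fdiff n (\<lambda>k. V r (j + k) / q r j * A r j k) 0" for r j
  define Y where "Y r j = fdiff n (\<lambda>k. V r (j + k) / q r j * B r j k) 0" for r j
  define X' where "X' = fdiff n (\<lambda>k. \<xi> k * affine_const (\<lambda>_. 1 + \<omega>) k) 0"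
  define Y' where "Y' = fdiff n (\<lambda>k. \<xi> k * (1 + \<omega>) ^ k) 0"
  define L where "L = (\<epsilon> - X') / (Y' - \<epsilon>)"
  have A: "((\<lambda>r. A r j k) \<longlongrightarrow> affine_const (\<lambda>_. 1 + \<omega>) k) at_top" for j k
    unfolding A_def by (intro tendsto_affine_const tendsto_intros W)
  have B: "((\<lambda>r. B r j k) \<longlongrightarrow> (1 + \<omega>) ^ k) at_top" for j k
  proof -
    have "((\<lambda>r. B r j k) \<longlongrightarrow> (\<Prod>i<k. 1 + \<omega>)) at_top"
      unfolding B_def by (intro tendsto_prod tendsto_intros W)
    then show ?thesis by simp
  qed
  have X: "((\<lambda>r. X r j) \<longlongrightarrow> X') at_top" for j
    unfolding X_def X'_def by (intro tendsto_fdiff tendsto_mult V A) auto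
  have Y: "((\<lambda>r. Y r j) \<longlongrightarrow> Y') at_top" for j
    unfolding Y_def Y'_def by (intro tendsto_fdiff tendsto_mult V B) auto
  \<comment> \<open>Every entry in the window j, ..., j + n is expressed through
    \<open>R r j\<close>. The coefficient on the left tends to \<open>Y' - \<epsilon>\<close>, which
    \<open>ne\<close> keeps away from 0.\<close>
  have lin: "R r j * (Y r j - 1 / q r j) = 1 / q r j - X r j" if r: "r > 0" for r j
  proof -
    have "1 + R r j = fdiff n (\<lambda>k. V r k * R r k) (0 + j)"
      using eqn[OF r, of j] by simp
    also have "\<dots> = fdiff n (\<lambda>k. V r (j + k) * R r (j + k)) 0"
      unfolding fdiff_shift by (simp add: add.commute)
    also have "(\<lambda>k. V r (j + k) * R r (j + k)) =
        (\<lambda>k. q r j * (V r (j + k) / q r j * A r j k + R r j * (V r (j + k) / q r j * B r j k)))"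
    proof
      fix k
      have "R r (j + k) = A r j k + B r j k * R r j"
        unfolding A_def B_def by (rule affine_recurrence) (rule rec[OF r])
      then show "V r (j + k) * R r (j + k) =
          q r j * (V r (j + k) / q r j * A r j k + R r j * (V r (j + k) / q r j * B r j k))"
        using q(2)[of r j] by (simp add: distrib_left)
    qed
    also have "fdiff n \<dots> 0 = q r j * (X r j + R r j * Y r j)"
      unfolding fdiff_mult_left fdiff_add X_def Y_def ..
    finally show ?thesis using q(2)[of r j] by (simp add: field_simps)
  qed
  have Rlim: "((\<lambda>r. R r j) \<longlongrightarrow> L) at_top" for j
  proof -
    have den: "((\<lambda>r. Y r j - 1 / q r j) \<longlongrightarrow> Y' - \<epsilon>) at_top"
      by (intro tendsto_diff Y q)
    have lim: "((\<lambda>r. (1 / q r j - X r j) / (Y r j - 1 / q r j)) \<longlongrightarrow> L) at_top"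
      unfolding L_def using ne by (intro tendsto_divide den tendsto_diff q X) (simp add: Y'_def)
    have "eventually (\<lambda>r. Y r j - 1 / q r j \<noteq> 0) at_top"
      using ne by (intro tendsto_imp_eventually_ne[OF den]) (simp add: Y'_def)
    then have "eventually (\<lambda>r. (1 / q r j - X r j) / (Y r j - 1 / q r j) = R r j) at_top"
      using eventually_gt_at_top[of 0]
      by eventually_elim (use lin in \<open>simp add: nonzero_divide_eq_eq\<close>)
    with lim show ?thesis by (rule Lim_transform_eventually)
  qed
  \<comment> \<open>The limit L is the same for all indices, so the recurrence from 0 to 1 becomes
    an equation for L alone.\<close>
  have "((\<lambda>r. R r 1) \<longlongrightarrow> 1 + (1 + \<omega>) * L) at_top"
  proof (rule Lim_transform_eventually)
    show "((\<lambda>r. 1 + (1 + W r 0) * R r 0) \<longlongrightarrow> 1 + (1 + \<omega>) * L) at_top"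
      by (intro tendsto_intros W Rlim)
    show "eventually (\<lambda>r. 1 + (1 + W r 0) * R r 0 = R r 1) at_top"
      using eventually_gt_at_top[of 0] by eventually_elim (use rec[of _ 0] in simp)
  qed
  then have L1: "L = 1 + (1 + \<omega>) * L"
    using tendsto_unique[OF trivial_limit_at_top_linorder] Rlim by blast
  \<comment> \<open>The second equation for L is the limit of the difference equation at index 0,
    divided by q.\<close>
  have "((\<lambda>r. fdiff n (\<lambda>k. V r (0 + k) / q r 0 * R r k) 0) \<longlongrightarrow> fdiff n (\<lambda>k. \<xi> k * L) 0) at_top"
    by (intro tendsto_fdiff tendsto_mult V Rlim) auto
  moreover have "eventually (\<lambda>r. fdiff n (\<lambda>k. V r (0 + k) / q r 0 * R r k) 0 = 1 / q r 0 * (1 + R r 0)) at_top"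
    using eventually_gt_at_top[of 0]
  proof eventually_elim
    case (elim r)
    have "fdiff n (\<lambda>k. V r (0 + k) / q r 0 * R r k) 0 = fdiff n (\<lambda>k. 1 / q r 0 * (V r k * R r k)) 0"
      by simp
    then show ?case unfolding fdiff_mult_left using eqn[OF elim, of 0] by simp
  qed
  ultimately have "((\<lambda>r. 1 / q r 0 * (1 + R r 0)) \<longlongrightarrow> fdiff n (\<lambda>k. \<xi> k * L) 0) at_top"
    by (rule Lim_transform_eventually)
  moreover have "((\<lambda>r. 1 / q r 0 * (1 + R r 0)) \<longlongrightarrow> \<epsilon> * (1 + L)) at_top"
    by (intro tendsto_intros q Rlim)
  ultimately have "fdiff n (\<lambda>k. \<xi> k * L) 0 = \<epsilon> * (1 + L)"
    using tendsto_unique[OF trivial_limit_at_top_linorder] by blast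
  then have "L * fdiff n \<xi> 0 = \<epsilon> * (1 + L)"
    by (simp add: fdiff_mult_left[symmetric] mult.commute)
  with L1 show ?thesis by blast
qed

text \<open>The recurrence has fixed point -1/w, so \<open>s k = (1 + w)^k h - 1/w\<close>, and the
  difference equation becomes one between exponentials in j. The indices 0 and 1 give (v w^n - 1) h
  = 0 and then w = 1; \<open>s 0 \<noteq> -1\<close> means h is nonzero, whence v = 1.\<close>

lemma constant_coefficients:
  fixes s :: "nat \<Rightarrow> complex"
  assumes n: "n > 0" and rec: "\<And>k. s (Suc k) = 1 + (1 + w) * s k"
    and eqn: "\<And>j. fdiff n (\<lambda>k. v * s k) j = 1 + s j"
    and "w \<noteq> 0" "s 0 \<noteq> -1"
  shows "w = 1 \<and> v = 1"
proof -
  define h where "h = s 0 + 1 / w"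
  have s: "s k = (1 + w) ^ k * h - 1 / w" for k
  proof (induction k)
    case (Suc k)
    have "s (Suc k) = 1 + (1 + w) * ((1 + w) ^ k * h - 1 / w)" by (simp add: rec Suc)
    also have "\<dots> = (1 + w) ^ Suc k * h + (1 - (1 + w) / w)" by (simp add: right_diff_distrib)
    also have "1 - (1 + w) / w = - (1 / w)" using assms(4) by (simp add: field_simps)
    finally show ?case by simp
  qed (simp add: h_def)
  have "fdiff n s j = w ^ n * (1 + w) ^ j * h" for j
  proof -
    have "fdiff n s j = fdiff n (\<lambda>k. h * (1 + w) ^ k - 1 / w) j"
      by (rule fdiff_cong) (simp add: s mult.commute)
    also have "\<dots> = h * (w ^ n * (1 + w) ^ j)"
      unfolding fdiff_diff fdiff_mult_left fdiff_power using n by (simp add: fdiff_const)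
    finally show ?thesis by simp
  qed
  then have e: "v * w ^ n * (1 + w) ^ j * h = 1 + s j" for j
    using eqn[of j] by (simp add: fdiff_mult_left mult.assoc)
  have e0: "(v * w ^ n - 1) * h = 1 - 1 / w"
    using e[of 0] by (simp add: s algebra_simps)
  have e1: "(v * w ^ n - 1) * h * (1 + w) = 1 - 1 / w"
    using e[of 1] by (simp add: s algebra_simps)
  have "(v * w ^ n - 1) * h * (1 + w) = (v * w ^ n - 1) * h" using e0 e1 by simp
  then have "(v * w ^ n - 1) * h * w = 0" 
    by (metis add_cancel_left_right distrib_left mult.right_neutral)
  then have "(v * w ^ n - 1) * h = 0" using assms(4) by simp
  with e0 have "1 - 1 / w = 0" by metis
  then have "w = 1" using assms(4) by (simp add: field_simps)
  moreover have "h \<noteq> 0" using \<open>w = 1\<close> assms(5) by (simp add: h_def eq_neg_iff_add_eq_0)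
  ultimately show ?thesis using \<open>(v * w ^ n - 1) * h = 0\<close> by simp
qed

text \<open>For large w each further difference is dominated by its shifted term, which contributes
  another factor w. The coefficients depend on w alone, and the leading limit picks up a power of
  \<nu> at each step, so it stays nonzero.\<close>

lemma fdiff_recurrence_infinity:
  fixes \<nu> :: complex
  assumes "\<nu> \<noteq> 0"
  shows "\<exists>C D c d. c \<noteq> 0 \<and> (C \<longlongrightarrow> c) at_infinity \<and> (D \<longlongrightarrow> d) at_infinity \<and>
    (\<forall>s w. (\<forall>k. w k \<noteq> 0 \<and> w (Suc k) = \<nu> * w k \<and> s (Suc k) = 1 + (1 + w k) * s k) \<longrightarrow>
      (\<forall>j. fdiff (Suc m) s j = w j ^ Suc m * C (w j) * s j + w j ^ m * D (w j)))"
proof (induction m)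
  case 0
  show ?case
    by (intro exI[of _ "\<lambda>_. 1"] exI[of _ 1]) (auto simp: algebra_simps)
next
  case (Suc m)
  then obtain C D c d where C: "c \<noteq> 0" "(C \<longlongrightarrow> c) at_infinity" "(D \<longlongrightarrow> d) at_infinity"
    and eq: "\<And>s w j. (\<And>k. w k \<noteq> 0 \<and> w (Suc k) = \<nu> * w k \<and> s (Suc k) = 1 + (1 + w k) * s k) \<Longrightarrow>
      fdiff (Suc m) s j = w j ^ Suc m * C (w j) * s j + w j ^ m * D (w j)"
    by blast
  define C' where "C' w = \<nu> ^ Suc m * C (\<nu> * w) * (1 + inverse w) - C w * inverse w" for w
  define D' where "D' w = \<nu> ^ Suc m * C (\<nu> * w) + (\<nu> ^ m * D (\<nu> * w) - D w) * inverse w" for w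
  have mult: "filterlim (\<lambda>w. \<nu> * w) at_infinity at_infinity"
    by (rule tendsto_mult_filterlim_at_infinity[OF tendsto_const assms filterlim_ident])
  note inv = tendsto_inverse_0[where 'a = complex]
  have "(C' \<longlongrightarrow> \<nu> ^ Suc m * c * (1 + 0) - c * 0) at_infinity"
    unfolding C'_def[abs_def]
    by (intro tendsto_intros inv C filterlim_compose[OF C(2) mult])
  moreover have "(D' \<longlongrightarrow> \<nu> ^ Suc m * c + (\<nu> ^ m * d - d) * 0) at_infinity"
    unfolding D'_def[abs_def]
    by (intro tendsto_intros inv C filterlim_compose[OF C(2) mult] filterlim_compose[OF C(3) mult])
  moreover have "fdiff (Suc (Suc m)) s j = w j ^ Suc (Suc m) * C' (w j) * s j + w j ^ Suc m * D' (w j)"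
    if h: "\<And>k. w k \<noteq> 0 \<and> w (Suc k) = \<nu> * w k \<and> s (Suc k) = 1 + (1 + w k) * s k" for s w j
  proof -
    have "fdiff (Suc (Suc m)) s j = fdiff (Suc m) s (Suc j) - fdiff (Suc m) s j" by simp
    also have "\<dots> = (\<nu> * w j) ^ Suc m * C (\<nu> * w j) * (1 + (1 + w j) * s j) + (\<nu> * w j) ^ m * D (\<nu> * w j) -
        (w j ^ Suc m * C (w j) * s j + w j ^ m * D (w j))"
      unfolding eq[of w s, OF h] using h[of j] by simp
    also have "\<dots> = w j ^ Suc (Suc m) * C' (w j) * s j + w j ^ Suc m * D' (w j)"
      using h[of j] unfolding C'_def D'_def by (simp add: power_mult_distrib field_simps)
    finally show ?thesis .
  qed
  ultimately show ?case
    using C(1) assms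
    by (intro exI[of _ C'] exI[of _ D'] exI[of _ "\<nu> ^ Suc m * c"] exI[of _ "\<nu> ^ Suc m * c"]) auto
qed

text \<open>The first difference 1 + w s is not small; the second loses the 1 and is of order w.
  Each later difference keeps this factor and multiplies the leading limit by \<nu> - 1, hence the
  start at order two and the condition \<nu> \<noteq> 1.\<close>

lemma fdiff_recurrence_zero:
  fixes \<nu> :: complex
  assumes "\<nu> \<noteq> 0" "\<nu> \<noteq> 1"
  shows "\<exists>C D c d. c \<noteq> 0 \<and> (C \<longlongrightarrow> c) (at 0) \<and> (D \<longlongrightarrow> d) (at 0) \<and>
    (\<forall>s w. (\<forall>k. w k \<noteq> 0 \<and> w (Suc k) = \<nu> * w k \<and> s (Suc k) = 1 + (1 + w k) * s k) \<longrightarrow>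
      (\<forall>j. fdiff (Suc (Suc m)) s j = w j * (C (w j) * s j + D (w j))))"
proof (induction m)
  case 0
  have "((\<lambda>w. \<nu> - 1 + \<nu> * w) \<longlongrightarrow> \<nu> - 1 + \<nu> * 0) (at 0)"
    by (intro tendsto_intros)
  then show ?case
    using assms
    by (intro exI[of _ "\<lambda>w. \<nu> - 1 + \<nu> * w"] exI[of _ "\<lambda>_. \<nu>"] exI[of _ "\<nu> - 1"] exI[of _ \<nu>])
       (auto simp: algebra_simps)
next
  case (Suc m)
  then obtain C D c d where C: "c \<noteq> 0" "(C \<longlongrightarrow> c) (at 0)" "(D \<longlongrightarrow> d) (at 0)"
    and eq: "\<And>s w j. (\<And>k. w k \<noteq> 0 \<and> w (Suc k) = \<nu> * w k \<and> s (Suc k) = 1 + (1 + w k) * s k) \<Longrightarrow>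
      fdiff (Suc (Suc m)) s j = w j * (C (w j) * s j + D (w j))"
    by blast
  define C' where "C' w = \<nu> * C (\<nu> * w) * (1 + w) - C w" for w
  define D' where "D' w = \<nu> * C (\<nu> * w) + \<nu> * D (\<nu> * w) - D w" for w
  have mult: "filterlim (\<lambda>w. \<nu> * w) (at 0) (at 0)"
    using assms by (auto simp: filterlim_at eventually_at intro!: tendsto_eq_intros exI[of _ 1])
  have "(C' \<longlongrightarrow> \<nu> * c * (1 + 0) - c) (at 0)"
    unfolding C'_def[abs_def]
    by (intro tendsto_intros C filterlim_compose[OF C(2) mult])
  moreover have "(D' \<longlongrightarrow> \<nu> * c + \<nu> * d - d) (at 0)"
    unfolding D'_def[abs_def]
    by (intro tendsto_intros C filterlim_compose[OF C(2) mult] filterlim_compose[OF C(3) mult])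
  moreover have "fdiff (Suc (Suc (Suc m))) s j = w j * (C' (w j) * s j + D' (w j))"
    if h: "\<And>k. w k \<noteq> 0 \<and> w (Suc k) = \<nu> * w k \<and> s (Suc k) = 1 + (1 + w k) * s k" for s w j
  proof -
    have "fdiff (Suc (Suc (Suc m))) s j = fdiff (Suc (Suc m)) s (Suc j) - fdiff (Suc (Suc m)) s j" by simp
    also have "\<dots> = \<nu> * w j * (C (\<nu> * w j) * (1 + (1 + w j) * s j) + D (\<nu> * w j)) -
        w j * (C (w j) * s j + D (w j))"
      unfolding eq[of w s, OF h] using h[of j] by simp
    also have "\<dots> = w j * (C' (w j) * s j + D' (w j))"
      unfolding C'_def D'_def by (simp add: algebra_simps)
    finally show ?thesis .
  qed
  moreover have "\<nu> * c * (1 + 0) - c \<noteq> 0"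
    using C(1) assms by simp
  ultimately show ?case
    by blast
qed

section \<open>Exponentials of polynomials on rays, and the choice of directions\<close>

lemma filterlim_real_poly_at_top:
  fixes p :: "real poly"
  assumes "degree p > 0" "lead_coeff p > 0"
  shows "filterlim (poly p) at_top at_top"
  unfolding filterlim_at_top
proof
  fix K
  have "degree (p - [:K:]) = degree p"
    unfolding diff_conv_add_uminus by (rule degree_add_eq_left) (use assms in simp)
  moreover have "coeff (p - [:K:]) (degree p) = lead_coeff p"
    using assms by (simp add: coeff_pCons split: nat.split)
  ultimately have "lead_coeff (p - [:K:]) > 0" using assms by simp
  then obtain N where "\<And>x. x \<ge> N \<Longrightarrow> poly (p - [:K:]) x \<ge> lead_coeff (p - [:K:])"
    using poly_pinfty_gt_lc by blast
  then have "K \<le> poly p x" if "x \<ge> N" for x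
    using that \<open>lead_coeff (p - [:K:]) > 0\<close> by fastforce
  then show "eventually (\<lambda>x. K \<le> poly p x) at_top"
    by (auto simp: eventually_at_top_linorder)
qed

lemma poly_map_poly_Re: "poly (map_poly Re q) r = Re (poly q (of_real r))"
  by (induction q) (auto simp: map_poly_pCons)

text \<open>Substituting r u + s and taking real parts of coefficients gives a real polynomial in r.
  Its leading coefficient does not involve s, so all orbit points behave alike.\<close>

lemma filterlim_Re_poly_ray:
  fixes q :: "complex poly"
  assumes "degree q > 0" "Re (lead_coeff q * u ^ degree q) > 0"
  shows "filterlim (\<lambda>r. Re (poly q (of_real r * u + s))) at_top at_top"
proof -
  define q' where "q' = pcompose q [:s, u:]"
  have u: "u \<noteq> 0" using assms by (auto simp: zero_power)
  have deg: "degree q' = degree q" using u by (simp add: q'_def degree_pcompose)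
  have lc: "lead_coeff q' = lead_coeff q * u ^ degree q"
    using u by (simp add: q'_def lead_coeff_comp)
  define p where "p = map_poly Re q'"
  have cp: "coeff p i = Re (coeff q' i)" for i by (simp add: p_def coeff_map_poly)
  have "coeff p (degree q) > 0" using cp lc deg assms by simp
  moreover have "degree p \<le> degree q"
    by (rule degree_le) (simp add: cp coeff_eq_0 deg)
  ultimately have "degree p = degree q" by (metis le_degree order_less_irrefl order_antisym)
  then have "filterlim (poly p) at_top at_top"
    using assms \<open>coeff p (degree q) > 0\<close> by (intro filterlim_real_poly_at_top) auto
  moreover have "poly p = (\<lambda>r. Re (poly q (of_real r * u + s)))"
    by (rule ext) (simp add: p_def poly_map_poly_Re q'_def poly_pcompose add.commute)
  ultimately show ?thesis by simp
qed

lemma exp_poly_ray_infinity: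
  fixes q :: "complex poly"
  assumes "degree q > 0" "Re (lead_coeff q * u ^ degree q) > 0"
  shows "filterlim (\<lambda>r. exp (poly q (of_real r * u + s))) at_infinity at_top"
    "((\<lambda>r. exp (- poly q (of_real r * u + s))) \<longlongrightarrow> 0) at_top"
proof -
  have f: "filterlim (\<lambda>r. exp (Re (poly q (of_real r * u + s)))) at_top at_top"
    by (rule filterlim_compose[OF exp_at_top filterlim_Re_poly_ray[OF assms]])
  then show "filterlim (\<lambda>r. exp (poly q (of_real r * u + s))) at_infinity at_top"
    by (intro filterlim_norm_at_top_imp_at_infinity) simp
  have "((\<lambda>r. inverse (exp (Re (poly q (of_real r * u + s))))) \<longlongrightarrow> 0) at_top"
    by (rule tendsto_inverse_0_at_top[OF f])
  then show "((\<lambda>r. exp (- poly q (of_real r * u + s))) \<longlongrightarrow> 0) at_top"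
    by (subst tendsto_norm_zero_iff[symmetric]) (simp add: exp_minus norm_inverse)
qed

lemma exp_poly_ray_zero:
  fixes q :: "complex poly"
  assumes "degree q > 0" "Re (lead_coeff q * u ^ degree q) < 0"
  shows "filterlim (\<lambda>r. exp (- poly q (of_real r * u + s))) at_infinity at_top"
    "((\<lambda>r. exp (poly q (of_real r * u + s))) \<longlongrightarrow> 0) at_top"
  using exp_poly_ray_infinity[of "- q" u s] assms by auto

text \<open>T contains a small arc starting near \<open>u0\<close>, which is uncountable;
  injectivity of the parametrisation is read off from the sine.\<close>

lemma unit_avoiding:
  fixes u0 :: complex
  assumes T: "open T" "u0 \<in> T" "norm u0 = 1" and B: "countable B"
  shows "\<exists>u\<in>T. norm u = 1 \<and> u \<notin> B"
proof -
  have "isCont (\<lambda>\<theta>. u0 * cis \<theta>) 0"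
    unfolding cis_conv_exp by (intro continuous_intros)
  then have "((\<lambda>\<theta>. u0 * cis \<theta>) \<longlongrightarrow> u0) (at 0)" by (simp add: isCont_def)
  then have "eventually (\<lambda>\<theta>. u0 * cis \<theta> \<in> T) (at 0)" using T topological_tendstoD by fastforce
  then obtain e where e: "e > 0" "\<And>\<theta>. \<theta> \<noteq> 0 \<Longrightarrow> \<bar>\<theta>\<bar> < e \<Longrightarrow> u0 * cis \<theta> \<in> T"
    by (auto simp: eventually_at dist_real_def)
  define J where "J = {0<..<min e 1}"
  have "inj_on (\<lambda>\<theta>. u0 * cis \<theta>) J"
  proof (rule inj_onI)
    fix x y assume xy: "x \<in> J" "y \<in> J" "u0 * cis x = u0 * cis y"
    then have "cis x = cis y" using T(3) by auto
    then have "sin x = sin y" by (metis cis.sel(2))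
    moreover have "- (pi / 2) \<le> x" "x \<le> pi / 2" "- (pi / 2) \<le> y" "y \<le> pi / 2"
      using xy(1,2) pi_ge_two by (auto simp: J_def)
    ultimately show "x = y" using sin_inj_pi by blast
  qed
  moreover have "uncountable J" using e(1) by (simp add: J_def uncountable_open_interval)
  ultimately have "uncountable ((\<lambda>\<theta>. u0 * cis \<theta>) ` J)" using countable_image_inj_on by blast
  then have "\<not> (\<lambda>\<theta>. u0 * cis \<theta>) ` J \<subseteq> B" using B countable_subset by blast
  then obtain \<theta> where "\<theta> \<in> J" "u0 * cis \<theta> \<notin> B" by blast
  then show ?thesis using e(2)[of \<theta>] T(3) by (intro bexI[of _ "u0 * cis \<theta>"]) (auto simp: J_def norm_mult)
qed

text \<open>On the unit circle cnj u = 1/u, so the condition becomes the polynomial equation l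
  u^(2m) + cnj l = 0.\<close>

lemma countable_unit_Re_zero:
  assumes "l \<noteq> 0" "m > 0"
  shows "countable {u. norm u = 1 \<and> Re (l * u ^ m) = 0}"
proof (rule countable_subset)
  define p where "p = monom l (2 * m) + [:cnj l:]"
  have "coeff p (2 * m) = l" using assms by (simp add: p_def coeff_pCons split: nat.split)
  then have "p \<noteq> 0" using assms by auto
  then show "countable {u. poly p u = 0}" using poly_roots_finite countable_finite by blast
  show "{u. norm u = 1 \<and> Re (l * u ^ m) = 0} \<subseteq> {u. poly p u = 0}"
  proof
    fix u assume "u \<in> {u. norm u = 1 \<and> Re (l * u ^ m) = 0}"
    then have u: "u * cnj u = 1" "Re (l * u ^ m) = 0" by (auto simp: complex_norm_square[symmetric])
    have "l * u ^ m + cnj (l * u ^ m) = 0" using u(2) complex_add_cnj[of "l * u ^ m"]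
      by (simp only: mult_zero_right of_real_0)
    then have "(l * u ^ m + cnj (l * u ^ m)) * u ^ m = 0" by simp
    then have "l * u ^ (2 * m) + cnj l * (u * cnj u) ^ m = 0"
      by (simp add: algebra_simps power_mult_distrib mult_2_right power_add)
    then show "u \<in> {u. poly p u = 0}" using u(1) by (simp add: p_def poly_monom)
  qed
qed

text \<open>The zeros are countable, and each nonzero one lies on exactly one ray.\<close>

lemma countable_zero_directions:
  assumes "h holomorphic_on UNIV" "h z0 \<noteq> (0::complex)"
  shows "countable {u. norm u = 1 \<and> (\<exists>r>0. h (of_real r * u) = 0)}"
proof (rule countable_subset)
  have "countable {z. h z = 0}"
  proof (cases "h constant_on UNIV")
    case True
    then have "{z. h z = 0} = {}" using assms by (auto simp: constant_on_def)
    then show ?thesis by simp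
  next
    case False
    then show ?thesis using holomorphic_countable_zeros[of h UNIV] assms by auto
  qed
  then show "countable ((\<lambda>z::complex. z / norm z) ` {z. h z = 0})" by simp
  show "{u. norm u = 1 \<and> (\<exists>r>0. h (of_real r * u) = 0)} \<subseteq> (\<lambda>z::complex. z / norm z) ` {z. h z = 0}"
  proof
    fix u assume "u \<in> {u. norm u = 1 \<and> (\<exists>r>0. h (of_real r * u) = 0)}"
    then obtain r where r: "norm u = 1" "r > 0" "h (of_real r * u) = 0" by auto
    then have "u = (of_real r * u) / norm (of_real r * u)" by (simp add: norm_mult)
    with r show "u \<in> (\<lambda>z::complex. z / norm z) ` {z. h z = 0}" by blast
  qed
qed

lemma exists_unit_Re_sign:
  assumes "l \<noteq> 0" "m > 0"
  shows "\<exists>u. norm u = 1 \<and> Re (l * u ^ m) > 0" "\<exists>u. norm u = 1 \<and> Re (l * u ^ m) < 0"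
proof -
  have *: "\<exists>u. norm u = 1 \<and> Re (l * u ^ m) > 0" if "l \<noteq> 0" for l
  proof -
    define u where "u = cis (- Arg l / m)"
    have "u ^ m = cis (- Arg l)" using assms(2) by (simp add: u_def Complex.DeMoivre)
    then have "l * u ^ m = rcis (norm l) (Arg l) * cis (- Arg l)" by (simp add: rcis_cmod_Arg)
    also have "\<dots> = norm l" by (simp add: rcis_def cis_mult mult.assoc)
    finally show ?thesis using that by (intro exI[of _ u]) (simp add: u_def)
  qed
  show "\<exists>u. norm u = 1 \<and> Re (l * u ^ m) > 0" by (rule *[OF assms(1)])
  show "\<exists>u. norm u = 1 \<and> Re (l * u ^ m) < 0" using *[of "- l"] assms(1) by simp
qed

text \<open>Rotating by \<open>\<plusminus>\<pi>/m\<close> changes the sign of \<open>l * u ^ m\<close>; one of the two rotations stays in the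
  half plane.\<close>

lemma exists_unit_two_signs:
  assumes "\<rho> \<noteq> 0" "l \<noteq> 0" "m > 0" and "m = 1 \<Longrightarrow> \<not> (\<exists>t>0. l = of_real t * \<rho>)"
  shows "\<exists>u. norm u = 1 \<and> Re (\<rho> * u) > 0 \<and> Re (l * u ^ m) < 0"
proof (cases "m = 1")
  case True
  define t where "t = l / \<rho>"
  have t: "t \<noteq> 0" "\<not> (\<exists>x>0. t = of_real x)"
    using assms True by (auto simp: t_def field_simps)
  obtain y where y: "Re y > 0" "Re (t * y) < 0"
  proof (cases "Im t = 0")
    case True
    then have "t = of_real (Re t)" by (simp add: complex_eq_iff)
    then have "Re t < 0" using t by (metis linorder_neqE_linordered_idom of_real_0)
    then show ?thesis using that[of 1] by simp
  next
    case False
    \<comment> \<open>The imaginary part of y is chosen so that Re (t y) = Re t - (Re t +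
      1).\<close>
    have "Re (t * Complex 1 ((Re t + 1) / Im t)) = -1" using False by simp
    then show ?thesis using that[of "Complex 1 ((Re t + 1) / Im t)"] by simp
  qed
  define k where "k = norm (y / \<rho>)"
  have k: "k > 0" using y assms by (auto simp: k_def)
  define u where "u = y / \<rho> / k"
  have "norm u = norm (y / \<rho>) / k" unfolding u_def norm_divide[of _ "of_real k"] using k by simp
  then have "norm u = 1" using k by (simp add: k_def)
  moreover have "\<rho> * u = y / k" "l * u ^ m = t * y / k"
    using assms True by (simp_all add: u_def t_def)
  ultimately show ?thesis using y k
    by (intro exI[of _ u]) (simp add: Re_divide_of_real divide_neg_pos)
next
  case False
  then have m: "m \<ge> 2" using assms by simp
  have "open {u. Re (\<rho> * u) > 0}" by (intro open_Collect_less continuous_intros)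
  moreover obtain u0 where "norm u0 = 1" "Re (\<rho> * u0) > 0"
    using exists_unit_Re_sign(1)[OF assms(1), of 1] by auto
  \<comment> \<open>Im (\<rho> u) = 0 is excluded as well: for m = 2 the rotation is by a right
    angle, and positivity after it rests on the sine term alone.\<close>
  moreover have "countable ({u. norm u = 1 \<and> Re (l * u ^ m) = 0} \<union>
      {u. norm u = 1 \<and> Re (\<i> * \<rho> * u ^ 1) = 0})"
    using assms by (intro countable_Un countable_unit_Re_zero) auto
  ultimately obtain u where "u \<in> {u. Re (\<rho> * u) > 0}" "norm u = 1"
    "u \<notin> {u. norm u = 1 \<and> Re (l * u ^ m) = 0} \<union> {u. norm u = 1 \<and> Re (\<i> * \<rho> * u ^ 1) = 0}"
    using unit_avoiding[of "{u. Re (\<rho> * u) > 0}" u0] by blast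
  then have u: "Re (\<rho> * u) > 0" "norm u = 1" "Re (l * u ^ m) \<noteq> 0" "Im (\<rho> * u) \<noteq> 0"
    by auto
  show ?thesis
  proof (cases "Re (l * u ^ m) < 0")
    case True
    then show ?thesis using u by blast
  next
    case False
    \<comment> \<open>The rotation goes towards the positive real axis, opposite to the sign of Im
      (\<rho> u), so that the sine term is positive.\<close>
    define \<sigma> :: real where "\<sigma> = (if Im (\<rho> * u) > 0 then -1 else 1)"
    define u' where "u' = u * cis (\<sigma> * pi / m)"
    have "cis (\<sigma> * pi / m) ^ m = cis (\<sigma> * pi)"
      using m by (simp add: Complex.DeMoivre)
    also have "\<dots> = -1" by (auto simp: \<sigma>_def complex_eq_iff)
    finally have "l * u' ^ m = - (l * u ^ m)" by (simp add: u'_def power_mult_distrib)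
    then have "Re (l * u' ^ m) < 0" using u False by simp
    moreover have "Re (\<rho> * u') > 0"
    proof -
      have pm: "0 < pi / m" "pi / m \<le> pi / 2" using m by (auto simp: field_simps)
      then have "sin (pi / m) > 0" by (intro sin_gt_zero) (use pi_gt_zero in linarith)+
      moreover have "cos (pi / m) \<ge> 0" using pm by (intro cos_ge_zero) auto
      moreover have "Re (\<rho> * u') = Re (\<rho> * u) * cos (pi / m) + \<bar>Im (\<rho> * u)\<bar> * sin (pi / m)"
      proof -
        have "\<rho> * u' = (\<rho> * u) * cis (\<sigma> * pi / m)" by (simp add: u'_def)
        then show ?thesis unfolding times_complex.sel(1)[of "\<rho> * u"] by (auto simp: \<sigma>_def algebra_simps)
      qed
      ultimately show ?thesis using u by (simp add: add_nonneg_pos)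
    qed
    ultimately show ?thesis using u by (intro exI[of _ u']) (simp add: u'_def norm_mult)
  qed
qed

section \<open>The system for \<open>G\<close>, \<open>v\<close> and \<open>w\<close>\<close>

text \<open>In the application \<open>a + G\<close> is the n-th difference of f, and
  \<open>exp (-p) G\<close> is f - a.\<close>

locale shift_system =
  fixes c :: complex and n :: nat and a G :: "complex \<Rightarrow> complex" and p d :: "complex poly"
  assumes c: "c \<noteq> 0" and n: "n > 0"
    and a: "a holomorphic_on UNIV" "\<exists>z. a z \<noteq> 0" "\<And>z. a (z + c) = a z"
    and G: "G holomorphic_on UNIV" "\<exists>z. a z + G z \<noteq> 0"
    and rec: "\<And>z. G (z + c) = a z + (1 + exp (poly d z)) * G z"
    and eqn: "\<And>z. fdiff n (\<lambda>k. exp (- poly p (z + of_nat k * c)) * G (z + of_nat k * c)) 0 = a z + G z"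
begin

definition V :: "complex \<Rightarrow> real \<Rightarrow> nat \<Rightarrow> complex" where
  "V u r k = exp (- poly p (of_real r * u + of_nat k * c))"

definition W :: "complex \<Rightarrow> real \<Rightarrow> nat \<Rightarrow> complex" where
  "W u r k = exp (poly d (of_real r * u + of_nat k * c))"

text \<open>By periodicity of \<open>a\<close>, the division at the base point is the division at
  every orbit point; it normalises the inhomogeneous terms to 1.\<close>

definition Q :: "complex \<Rightarrow> real \<Rightarrow> nat \<Rightarrow> complex" where
  "Q u r k = G (of_real r * u + of_nat k * c) / a (of_real r * u)"

text \<open>Nonvanishing of \<open>a\<close> makes Q meaningful on the ray; nonvanishing of
  \<open>a + G\<close> keeps Q at index 0 away from -1.\<close>

definition good :: "complex \<Rightarrow> bool" where
  "good u \<longleftrightarrow> norm u = 1 \<and> (\<forall>r>0. a (of_real r * u) \<noteq> 0 \<and> a (of_real r * u) + G (of_real r * u) \<noteq> 0)"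

lemma V_nz [simp]: "V u r k \<noteq> 0" and W_nz [simp]: "W u r k \<noteq> 0"
  by (simp_all add: V_def W_def)

lemmas a_periodic = periodic_of_nat[of a, OF a(3)]

lemma Q_rec:
  assumes "good u" "r > 0"
  shows "Q u r (Suc k) = 1 + (1 + W u r k) * Q u r k"
proof -
  define z where "z = of_real r * u"
  have az: "a z \<noteq> 0" using assms by (simp add: good_def z_def)
  have "G (z + of_nat (Suc k) * c) = a z + (1 + exp (poly d (z + of_nat k * c))) * G (z + of_nat k * c)"
    using rec[of "z + of_nat k * c"] unfolding a_periodic by (simp add: algebra_simps)
  then show ?thesis using az unfolding Q_def W_def z_def[symmetric] by (simp add: field_simps)
qed

lemma Q_eqn:
  assumes "good u" "r > 0"
  shows "fdiff n (\<lambda>k. V u r k * Q u r k) j = 1 + Q u r j"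
proof -
  define z where "z = of_real r * u"
  have az: "a z \<noteq> 0" using assms by (simp add: good_def z_def)
  have "fdiff n (\<lambda>k. V u r k * Q u r k) (0 + j) =
      fdiff n (\<lambda>k. (1 / a z) * (exp (- poly p (z + of_nat j * c + of_nat k * c)) *
        G (z + of_nat j * c + of_nat k * c))) 0"
    unfolding fdiff_shift V_def Q_def z_def[symmetric] by (simp add: algebra_simps)
  also have "\<dots> = (1 / a z) * (a z + G (z + of_nat j * c))"
    unfolding fdiff_mult_left eqn by (simp add: a_periodic)
  also have "\<dots> = 1 + Q u r j" 
    using az unfolding Q_def z_def[symmetric] by (simp add: field_simps)
  finally show ?thesis by simp
qed

lemma Q_ne:
  assumes "good u" "r > 0"
  shows "Q u r 0 \<noteq> -1"
proof
  assume "Q u r 0 = -1"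
  then have "a (of_real r * u) + G (of_real r * u) = 0"
    using assms by (simp add: Q_def good_def field_simps)
  then show False using assms by (simp add: good_def)
qed

lemma exists_good:
  assumes "open T" "u0 \<in> T" "norm u0 = 1" "countable B"
  shows "\<exists>u\<in>T. good u \<and> u \<notin> B"
proof -
  obtain z1 z2 where z: "a z1 \<noteq> 0" "a z2 + G z2 \<noteq> 0" using a(2) G(2) by blast
  have hol: "(\<lambda>z. a z + G z) holomorphic_on UNIV" using a(1) G(1) by (rule holomorphic_on_add)
  define B' where "B' = B \<union> {u. norm u = 1 \<and> (\<exists>r>0. a (of_real r * u) = 0)} \<union>
      {u. norm u = 1 \<and> (\<exists>r>0. a (of_real r * u) + G (of_real r * u) = 0)}"
  have "countable B'"
    unfolding B'_def
    using assms(4) countable_zero_directions[OF a(1) z(1)] countable_zero_directions[OF hol z(2)]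
    by (intro countable_Un)
  then obtain u where "u \<in> T" "norm u = 1" "u \<notin> B'"
    using unit_avoiding[OF assms(1-3)] by blast
  then show ?thesis by (auto simp: B'_def good_def)
qed

text \<open>The normalisation q follows v: it is the constant 1, with \<epsilon> = 1, when v
  converges, and a dominant value of v in the window, with \<epsilon> = 0, when v tends to
  infinity.\<close>

lemma limit_equations:
  assumes "good u" "\<And>k. ((\<lambda>r. W u r k) \<longlongrightarrow> \<omega>) at_top"
    and "\<And>j k. k \<le> n \<Longrightarrow> ((\<lambda>r. V u r (j + k) / q r j) \<longlongrightarrow> \<xi> k) at_top"
    and "\<And>j. ((\<lambda>r. 1 / q r j) \<longlongrightarrow> \<epsilon>) at_top" "\<And>j r. q r j \<noteq> 0"
    and "fdiff n (\<lambda>k. \<xi> k * (1 + \<omega>) ^ k) 0 \<noteq> \<epsilon>"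
  shows "\<exists>L. L = 1 + (1 + \<omega>) * L \<and> L * fdiff n \<xi> 0 = \<epsilon> * (1 + L)"
  by (rule recurrence_limit[where R = "Q u" and V = "V u" and W = "W u" and q = q])
     (use assms Q_rec Q_eqn in auto)

text \<open>If v -> 0 the difference equation gives 1 + L = 0, and L = -1 satisfies the limit
  recurrence only for \<omega> = 1.\<close>

lemma limit_V_zero:
  assumes "good u" "\<And>k. ((\<lambda>r. W u r k) \<longlongrightarrow> \<omega>) at_top" "\<And>k. ((\<lambda>r. V u r k) \<longlongrightarrow> 0) at_top"
  shows "\<omega> = 1"
proof -
  have "\<exists>L. L = 1 + (1 + \<omega>) * L \<and> L * fdiff n (\<lambda>_. 0) 0 = 1 * (1 + L)"
    by (rule limit_equations[OF assms(1,2), where q = "\<lambda>_ _. 1"])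
       (use assms(3) n in \<open>auto simp: fdiff_const\<close>)
  then obtain L where L: "L = 1 + (1 + \<omega>) * L" "1 + L = 0" by (auto simp: fdiff_const[OF n])
  then have "L = -1" by (simp add: eq_neg_iff_add_eq_0 add.commute)
  with L(1) show ?thesis by simp
qed

text \<open>The exponential of \<open>-dp\<close> is the ratio v(z + c) / v(z).\<close>

definition dp :: "complex poly" where
  "dp = pcompose p [:c, 1:] - p"

lemma poly_dp: "poly dp z = poly p (z + c) - poly p z"
  by (simp add: dp_def poly_pcompose add.commute)

lemma V_add:
  "V u r (j + e) = V u r j * (\<Prod>i<e. exp (- poly dp (of_real r * u + of_nat (j + i) * c)))"
proof (induction e)
  case (Suc e)
  have "V u r (j + Suc e) = V u r (j + e) * exp (- poly dp (of_real r * u + of_nat (j + e) * c))"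
    unfolding V_def poly_dp by (simp add: algebra_simps flip: exp_add)
  with Suc show ?case by simp
qed simp

text \<open>Here v -> infinity and its ratio tends to 0 or infinity, so one end of the window
  dominates. After normalisation a single extreme binomial coefficient survives; this forces L = 0,
  which the limit recurrence excludes.\<close>

lemma dominant_V:
  assumes "good u" "\<And>k. ((\<lambda>r. W u r k) \<longlongrightarrow> \<omega>) at_top" "\<omega> \<noteq> -1"
    and "degree p > 0" "Re (lead_coeff p * u ^ degree p) < 0"
    and "degree dp > 0" "Re (lead_coeff dp * u ^ degree dp) \<noteq> 0"
  shows False
proof -
  have Vinf: "((\<lambda>r. 1 / V u r k) \<longlongrightarrow> 0) at_top" for k
  proof -
    have "((\<lambda>r. exp (poly p (of_real r * u + of_nat k * c))) \<longlongrightarrow> 0) at_top"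
      by (rule exp_poly_ray_zero) fact+
    then show ?thesis by (simp add: V_def exp_minus inverse_eq_divide[symmetric])
  qed
  show False
  proof (cases "Re (lead_coeff dp * u ^ degree dp) > 0")
    case True
    define \<xi> where "\<xi> k = (if k = 0 then 1 else 0 :: complex)" for k :: nat
    have S: "fdiff n (\<lambda>k. \<xi> k * (1 + \<omega>) ^ k) 0 = (-1) ^ n" "fdiff n \<xi> 0 = (-1) ^ n"
      by (subst fdiff_bot; simp add: \<xi>_def)+
    have "\<exists>L. L = 1 + (1 + \<omega>) * L \<and> L * fdiff n \<xi> 0 = 0 * (1 + L)"
    proof (rule limit_equations[OF assms(1,2), where q = "V u"])
      fix j k :: nat
      have "((\<lambda>r. \<Prod>i<k. exp (- poly dp (of_real r * u + of_nat (j + i) * c))) \<longlongrightarrow> (\<Prod>i<k. 0)) at_top"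
        by (intro tendsto_prod exp_poly_ray_infinity assms True)
      also have "(\<Prod>i<k. 0) = \<xi> k" by (simp add: \<xi>_def)
      finally show "((\<lambda>r. V u r (j + k) / V u r j) \<longlongrightarrow> \<xi> k) at_top"
        unfolding V_add by simp
    qed (use Vinf S in auto)
    then obtain L where "L = 1 + (1 + \<omega>) * L" "L * (-1) ^ n = 0" unfolding S by auto
    then show False by simp
  next
    case False
    then have neg: "Re (lead_coeff dp * u ^ degree dp) < 0" using assms by simp
    define \<xi> where "\<xi> k = (if k = n then 1 else 0 :: complex)" for k :: nat
    have S: "fdiff n (\<lambda>k. \<xi> k * (1 + \<omega>) ^ k) 0 = (1 + \<omega>) ^ n" "fdiff n \<xi> 0 = 1"
      by (subst fdiff_top; simp add: \<xi>_def)+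
    \<comment> \<open>When the upper end dominates, the coefficient of \<open>s j\<close> tends to
      (1 + \<omega>)^n, so \<omega> = -1 must be excluded.\<close>
    have ne: "1 + \<omega> \<noteq> 0" using assms(3) by (simp add: add_eq_0_iff)
    have "\<exists>L. L = 1 + (1 + \<omega>) * L \<and> L * fdiff n \<xi> 0 = 0 * (1 + L)"
    proof (rule limit_equations[OF assms(1,2), where q = "\<lambda>r j. V u r (j + n)"])
      fix j k :: nat assume k: "k \<le> n"
      define e where "e = n - k"
      have "((\<lambda>r. \<Prod>i<e. exp (poly dp (of_real r * u + of_nat (j + k + i) * c))) \<longlongrightarrow> (\<Prod>i<e. 0)) at_top"
        by (intro tendsto_prod exp_poly_ray_zero assms neg)
      also have "(\<Prod>i<e. 0) = \<xi> k" using k by (simp add: \<xi>_def e_def)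
      also have "(\<lambda>r. \<Prod>i<e. exp (poly dp (of_real r * u + of_nat (j + k + i) * c))) =
          (\<lambda>r. V u r (j + k) / V u r (j + n))"
      proof
        fix r
        have "V u r (j + n) = V u r (j + k + e)" using k by (simp add: e_def)
        then show "(\<Prod>i<e. exp (poly dp (of_real r * u + of_nat (j + k + i) * c))) =
            V u r (j + k) / V u r (j + n)"
          unfolding V_add[of u r "j + k" e] exp_minus prod_inversef[unfolded o_def]
          by (simp add: inverse_eq_divide)
      qed
      finally show "((\<lambda>r. V u r (j + k) / V u r (j + n)) \<longlongrightarrow> \<xi> k) at_top" .
    qed (use Vinf S ne in auto)
    then obtain L where "L = 1 + (1 + \<omega>) * L" "L = 0" unfolding S by auto
    then show False by simp
  qed
qed

text \<open>A constant increment makes p agree with a linear polynomial at the infinitely many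
  points k c.\<close>

lemma degree_dp_zero_imp:
  assumes "degree dp = 0"
  shows "degree p \<le> 1"
proof -
  obtain \<kappa> where "dp = [:\<kappa>:]" using assms by (rule degree_eq_zeroE)
  then have "poly dp z = \<kappa>" for z by simp
  then have step: "poly p (z + c) = poly p z + \<kappa>" for z
    using poly_dp[of z] by (simp add: algebra_simps)
  have val: "poly p (of_nat k * c) = poly p 0 + of_nat k * \<kappa>" for k
  proof (induction k)
    case (Suc k)
    have "poly p (of_nat (Suc k) * c) = poly p (of_nat k * c) + \<kappa>"
      using step[of "of_nat k * c"] by (simp add: algebra_simps)
    with Suc show ?case by (simp add: algebra_simps)
  qed simp
  define q where "q = p - [:poly p 0, \<kappa> / c:]"
  have "range (\<lambda>k. of_nat k * c) \<subseteq> {z. poly q z = 0}"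
    using c by (auto simp: q_def val)
  moreover have "inj (\<lambda>k. of_nat k * c :: complex)" using c by (auto simp: inj_on_def)
  ultimately have "infinite {z. poly q z = 0}" using finite_subset range_inj_infinite by blast
  then have "q = 0" using poly_roots_finite by blast
  then have "p = [:poly p 0, \<kappa> / c:]" by (simp add: q_def)
  then show ?thesis by (metis degree_pCons_le degree_pCons_0 One_nat_def order.trans Suc_le_mono le0)
qed

section \<open>Case analysis on the exponents\<close>

lemma V_zero:
  assumes "degree p > 0" "Re (lead_coeff p * u ^ degree p) > 0"
  shows "((\<lambda>r. V u r k) \<longlongrightarrow> 0) at_top"
  unfolding V_def by (rule exp_poly_ray_infinity) fact+

lemma W_zero:
  assumes "degree d > 0" "Re (lead_coeff d * u ^ degree d) < 0"
  shows "((\<lambda>r. W u r k) \<longlongrightarrow> 0) at_top"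
  unfolding W_def by (rule exp_poly_ray_zero) fact+

lemma exists_good_halfplane:
  assumes "l \<noteq> 0" "m > 0" "countable B"
  shows "\<exists>u. good u \<and> u \<notin> B \<and> Re (l * u ^ m) > 0" "\<exists>u. good u \<and> u \<notin> B \<and> Re (l * u ^ m) < 0"
proof -
  have "open {u. Re (l * u ^ m) > 0}" "open {u. Re (l * u ^ m) < 0}"
    by (intro open_Collect_less continuous_intros)+
  then show "\<exists>u. good u \<and> u \<notin> B \<and> Re (l * u ^ m) > 0" "\<exists>u. good u \<and> u \<notin> B \<and> Re (l * u ^ m) < 0"
    using exists_unit_Re_sign[OF assms(1,2)] exists_good[OF _ _ _ assms(3)] by blast+
qed

text \<open>All ratios \<open>v(z + c) / v(z)\<close>, \<open>w(z + c) / w(z)\<close> are constant here, and the growth of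
  \<open>v w\<^sup>n\<close> along the ray decides which limits are forced.\<close>

lemma linear_case_False:
  assumes p: "p = [:b, \<rho>:]" "\<rho> \<noteq> 0" "exp (\<rho> * c) = 1" and d: "d = [:b', of_real t * \<rho>:]" "t > 0"
  shows False
proof -
  define \<nu> where "\<nu> = exp (of_real t * \<rho> * c)"
  have \<nu>: "\<nu> \<noteq> 0" by (simp add: \<nu>_def)
  have pz: "poly p z = b + z * \<rho>" and dz: "poly d z = b' + z * (of_real t * \<rho>)" for z
    using p d by simp_all
  have V: "V u r k = V u r 0" for u r k
  proof (induction k)
    case (Suc k)
    have "V u r (Suc k) = V u r k * exp (- (\<rho> * c))"
      by (simp add: V_def pz algebra_simps flip: exp_add)
    with Suc show ?case using p(3) by (simp add: exp_minus)
  qed simp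
  have W: "W u r (Suc k) = \<nu> * W u r k" for u r k
    by (simp add: W_def dz \<nu>_def algebra_simps flip: exp_add)
  then have Wj: "W u r j = \<nu> ^ j * W u r 0" for u r j
    by (induction j) auto
  have eq: "V u r 0 * fdiff n (Q u r) j = 1 + Q u r j" if "good u" "r > 0" for u r j
  proof -
    have "fdiff n (\<lambda>k. V u r k * Q u r k) j = fdiff n (\<lambda>k. V u r 0 * Q u r k) j"
      by (rule fdiff_cong) (metis V)
    with Q_eqn[OF that, of j] show ?thesis by (simp only: fdiff_mult_left)
  qed
  have dd: "degree d = 1" "lead_coeff d = of_real t * \<rho>" "degree p = 1" "lead_coeff p = \<rho>"
    using p d by auto
  have pos: "eventually (\<lambda>r::real. r > 0) at_top" by (rule eventually_gt_at_top)
  have nz: "at_top \<noteq> (bot :: real filter)" by simp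
  have Re_of_real_mult: "Re (of_real x * y) = x * Re y" for x y by simp
  have sgn: "Re (of_real t * \<rho> * u ^ 1) = t * Re (\<rho> * u)" for u
    by (simp add: algebra_simps)
  \<comment> \<open>The exponent of v w^n has slope (n t - 1) \<rho>. For n t = 1 this product is
    constant and decides nothing; v w on a ray with w -> 0 takes over there.\<close>
  consider "\<nu> = 1" | "\<nu> \<noteq> 1" "of_nat n * t \<noteq> 1" | "\<nu> \<noteq> 1" "of_nat n * t = 1" by blast
  then show False
  proof cases
    case 1
    obtain u where u: "good u" "Re (\<rho> * u ^ 1) < 0"
      using exists_good_halfplane(2)[OF p(2), of 1 "{}"] by auto
    \<comment> \<open>Both v and w are constant on each orbit now, which forces w = 1 at every point
      of a ray on which w -> 0.\<close>
    have "W u r 0 = 1" if "r > 0" for r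
    proof -
      have "W u r 0 = 1 \<and> V u r 0 = 1"
      proof (rule constant_coefficients[OF n, of "Q u r"])
        show "Q u r (Suc k) = 1 + (1 + W u r 0) * Q u r k" for k
          using Q_rec[OF u(1) that, of k] Wj[of u r k] 1 by simp
        show "fdiff n (\<lambda>k. V u r 0 * Q u r k) j = 1 + Q u r j" for j
          using eq[OF u(1) that] by (simp only: fdiff_mult_left)
      qed (use Q_ne u that in auto)
      then show ?thesis by simp
    qed
    then have "eventually (\<lambda>r. W u r 0 = 1) at_top" by (auto intro: eventually_mono[OF pos])
    then have "((\<lambda>r. W u r 0) \<longlongrightarrow> 1) at_top" by (rule tendsto_eventually)
    moreover have "((\<lambda>r. W u r 0) \<longlongrightarrow> 0) at_top"
      by (rule W_zero) (use dd sgn[of u] u d(2) in \<open>auto simp: mult_pos_neg\<close>)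
    ultimately show False using tendsto_unique[OF nz] by fastforce
  next
    case 2
    obtain u where u: "good u" "Re (\<rho> * u ^ 1) > 0"
      using exists_good_halfplane(1)[OF p(2), of 1 "{}"] by auto
    have V0: "((\<lambda>r. V u r 0) \<longlongrightarrow> 0) at_top"
      by (rule V_zero) (use dd u in auto)
    have Winf: "filterlim (\<lambda>r. W u r j) at_infinity at_top" for j
      unfolding W_def
      by (rule exp_poly_ray_infinity) (use dd sgn[of u] u d(2) in auto)
    have iW: "((\<lambda>r. inverse (W u r j)) \<longlongrightarrow> 0) at_top" for j
      by (rule filterlim_compose[OF tendsto_inverse_0 Winf])
    define m where "m = n - 1"
    have nm: "n = Suc m" using n by (simp add: m_def)
    obtain C D c' d' where CD: "c' \<noteq> 0" "(C \<longlongrightarrow> c') at_infinity" "(D \<longlongrightarrow> d') at_infinity"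
      and fd: "\<And>s w j. (\<And>k. w k \<noteq> 0 \<and> w (Suc k) = \<nu> * w k \<and> s (Suc k) = 1 + (1 + w k) * s k) \<Longrightarrow>
        fdiff n s j = w j ^ n * C (w j) * s j + w j ^ m * D (w j)"
      using fdiff_recurrence_infinity[OF \<nu>, of m] unfolding nm by blast
    have C: "((\<lambda>r. C (W u r j)) \<longlongrightarrow> c') at_top" and D: "((\<lambda>r. D (W u r j)) \<longlongrightarrow> d') at_top" for j
      by (rule filterlim_compose[OF CD(2) Winf] filterlim_compose[OF CD(3) Winf])+
    define X where "X r j = V u r 0 * W u r j ^ n" for r j
    have Xnz: "X r j \<noteq> 0" for r j by (simp add: X_def)
    define e where "e = of_nat n * d - p"
    have e: "e = [:of_nat n * b' - b, of_real (of_nat n * t - 1) * \<rho>:]"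
      by (simp add: e_def p d of_nat_poly algebra_simps)
    have ede: "degree e = 1" "lead_coeff e = of_real (of_nat n * t - 1) * \<rho>"
    proof -
      have "complex_of_real (of_nat n * t - 1) \<noteq> 0" using 2 by (simp only: of_real_eq_0_iff)
      then show "degree e = 1" "lead_coeff e = of_real (of_nat n * t - 1) * \<rho>"
        using p(2) unfolding e by (auto simp del: of_real_diff of_real_mult)
    qed
    have X0: "X r 0 = exp (poly e (of_real r * u + 0))" for r
      by (simp add: X_def V_def W_def e_def exp_diff exp_minus field_simps flip: exp_of_nat_mult)
    have Xj: "X r j = (\<nu> ^ j) ^ n * X r 0" for r j
      by (simp add: X_def Wj[of u r j] power_mult_distrib)
    \<comment> \<open>The difference equation after inserting the expansion at infinity; whether X =
      v w^n tends to infinity or to 0 decides which side of each difference dominates.\<close>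
    have lin: "Q u r j * (X r j * C (W u r j) - 1) = 1 - X r j * inverse (W u r j) * D (W u r j)"
      if r: "r > 0" for r j
    proof -
      have "fdiff n (Q u r) j = W u r j ^ n * C (W u r j) * Q u r j + W u r j ^ m * D (W u r j)"
        by (rule fd) (use Q_rec[OF u(1) r] W in auto)
      then have "V u r 0 * (W u r j ^ n * C (W u r j) * Q u r j + W u r j ^ m * D (W u r j)) = 1 + Q u r j"
        using eq[OF u(1) r, of j] by simp
      moreover have "V u r 0 * W u r j ^ m = X r j * inverse (W u r j)"
        by (simp add: X_def nm)
      ultimately show ?thesis by (simp add: X_def algebra_simps)
    qed
    have "lead_coeff e * u ^ degree e = of_real (of_nat n * t - 1) * (\<rho> * u)"
      by (simp only: ede(2)) (simp add: ede(1))
    then have slope: "Re (lead_coeff e * u ^ degree e) = (of_nat n * t - 1) * Re (\<rho> * u)"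
      by (simp only: Re_of_real_mult)
    show False
    proof (cases "of_nat n * t > 1")
      case True
      have "filterlim (\<lambda>r. X r 0) at_infinity at_top"
        unfolding X0 by (rule exp_poly_ray_infinity) (use ede slope True u in auto)
      then have "((\<lambda>r. inverse (X r 0)) \<longlongrightarrow> 0) at_top"
        by (rule filterlim_compose[OF tendsto_inverse_0])
      then have "((\<lambda>r. inverse ((\<nu> ^ j) ^ n) * inverse (X r 0)) \<longlongrightarrow> inverse ((\<nu> ^ j) ^ n) * 0) at_top" for j
        by (intro tendsto_mult tendsto_const)
      then have iX: "((\<lambda>r. inverse (X r j)) \<longlongrightarrow> 0) at_top" for j
        unfolding Xj[of _ j] by simp
      have Qlim: "((\<lambda>r. Q u r j) \<longlongrightarrow> 0) at_top" for j
      proof -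
        have den: "((\<lambda>r. C (W u r j) - inverse (X r j)) \<longlongrightarrow> c' - 0) at_top"
          by (intro tendsto_diff C iX)
        have "((\<lambda>r. (inverse (X r j) - inverse (W u r j) * D (W u r j)) / (C (W u r j) - inverse (X r j)))
            \<longlongrightarrow> (0 - 0 * d') / (c' - 0)) at_top"
          using CD(1) by (intro tendsto_divide den tendsto_diff tendsto_mult iX iW D) auto
        moreover have "eventually (\<lambda>r. C (W u r j) - inverse (X r j) \<noteq> 0) at_top"
          using CD(1) by (intro tendsto_imp_eventually_ne[OF den]) simp
        then have "eventually (\<lambda>r. (inverse (X r j) - inverse (W u r j) * D (W u r j)) /
            (C (W u r j) - inverse (X r j)) = Q u r j) at_top"
          using pos
        proof eventually_elim
          case (elim r)
          have "x * (s * (y - inverse x)) = s * (x * y - 1)" "x * (inverse x - s * y) = 1 - x * s * y"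
            if "x \<noteq> 0" for x y s :: complex
            using that by (simp_all add: field_simps)
          then have "X r j * (Q u r j * (C (W u r j) - inverse (X r j))) =
              X r j * (inverse (X r j) - inverse (W u r j) * D (W u r j))"
            using lin[OF elim(2), of j] Xnz[of r j] by metis
          then have "Q u r j * (C (W u r j) - inverse (X r j)) =
              inverse (X r j) - inverse (W u r j) * D (W u r j)"
            using Xnz[of r j] by (simp only: mult_cancel_left) simp
          then show ?case using elim(1) by (simp add: nonzero_divide_eq_eq)
        qed
        ultimately have "((\<lambda>r. Q u r j) \<longlongrightarrow> (0 - 0 * d') / (c' - 0)) at_top"
          by (rule Lim_transform_eventually)
        then show ?thesis by simp
      qed
      \<comment> \<open>All Q tend to 0 and so does v: the left side of the difference equation
        tends to 0, the right side to 1.\<close>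
      have "((\<lambda>r. V u r 0 * fdiff n (Q u r) 0) \<longlongrightarrow> 0 * fdiff n (\<lambda>_. 0) 0) at_top"
        by (intro tendsto_mult V0 tendsto_fdiff Qlim)
      moreover have "eventually (\<lambda>r. V u r 0 * fdiff n (Q u r) 0 = 1 + Q u r 0) at_top"
        using pos by eventually_elim (rule eq[OF u(1)])
      ultimately have "((\<lambda>r. 1 + Q u r 0) \<longlongrightarrow> 0 * fdiff n (\<lambda>_. 0) 0) at_top"
        by (rule Lim_transform_eventually)
      moreover have "((\<lambda>r. 1 + Q u r 0) \<longlongrightarrow> 1 + 0) at_top"
        by (intro tendsto_add tendsto_const Qlim)
      ultimately show False using tendsto_unique[OF nz] by fastforce
    next
      case False
      then have neg: "of_nat n * t - 1 < 0" using 2 by simp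
      have "((\<lambda>r. X r 0) \<longlongrightarrow> 0) at_top"
        unfolding X0 by (rule exp_poly_ray_zero) (use ede slope neg u in \<open>auto simp: mult_neg_pos\<close>)
      then have "((\<lambda>r. (\<nu> ^ j) ^ n * X r 0) \<longlongrightarrow> (\<nu> ^ j) ^ n * 0) at_top" for j
        by (intro tendsto_mult tendsto_const)
      then have Xlim: "((\<lambda>r. X r j) \<longlongrightarrow> 0) at_top" for j
        unfolding Xj[of _ j] by simp
      have Qlim: "((\<lambda>r. Q u r j) \<longlongrightarrow> -1) at_top" for j
      proof -
        have den: "((\<lambda>r. X r j * C (W u r j) - 1) \<longlongrightarrow> 0 * c' - 1) at_top"
          by (intro tendsto_diff tendsto_mult tendsto_const Xlim C)
        have "((\<lambda>r. (1 - X r j * inverse (W u r j) * D (W u r j)) / (X r j * C (W u r j) - 1))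
            \<longlongrightarrow> (1 - 0 * 0 * d') / (0 * c' - 1)) at_top"
          by (intro tendsto_divide den tendsto_diff tendsto_mult tendsto_const Xlim iW D) auto
        moreover have "eventually (\<lambda>r. X r j * C (W u r j) - 1 \<noteq> 0) at_top"
          by (intro tendsto_imp_eventually_ne[OF den]) simp
        then have "eventually (\<lambda>r. (1 - X r j * inverse (W u r j) * D (W u r j)) /
            (X r j * C (W u r j) - 1) = Q u r j) at_top"
          using pos by eventually_elim (use lin in \<open>simp add: nonzero_divide_eq_eq\<close>)
        ultimately have "((\<lambda>r. Q u r j) \<longlongrightarrow> (1 - 0 * 0 * d') / (0 * c' - 1)) at_top"
          by (rule Lim_transform_eventually)
        then show ?thesis by simp
      qed
      \<comment> \<open>Solving the recurrence for w: as all Q tend to -1, w would have the finite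
        limit 1.\<close>
      have "((\<lambda>r. (Q u r 1 - 1) / Q u r 0 - 1) \<longlongrightarrow> (-1 - 1) / -1 - 1) at_top"
        by (intro tendsto_diff tendsto_divide tendsto_const Qlim) simp
      moreover have "eventually (\<lambda>r. Q u r 0 \<noteq> 0) at_top"
        by (rule tendsto_imp_eventually_ne[OF Qlim]) simp
      then have "eventually (\<lambda>r. (Q u r 1 - 1) / Q u r 0 - 1 = W u r 0) at_top"
        using pos by eventually_elim (use Q_rec[OF u(1), of _ 0] in \<open>simp add: field_simps\<close>)
      ultimately have "((\<lambda>r. W u r 0) \<longlongrightarrow> (-1 - 1) / -1 - 1) at_top"
        by (rule Lim_transform_eventually)
      then show False
        using not_tendsto_and_filterlim_at_infinity[OF nz] Winf[of 0] by blast
    qed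
  next
    case 3
    have "\<nu> ^ n = exp (of_nat n * (of_real t * \<rho> * c))" by (simp add: \<nu>_def exp_of_nat_mult)
    also have "of_nat n * (of_real t * \<rho> * c) = of_real (of_nat n * t) * (\<rho> * c)" by simp
    also have "exp \<dots> = 1" unfolding 3(2) using p(3) by simp
    finally have "\<nu> ^ n = 1" .
    \<comment> \<open>\<nu> is an n-th root of unity other than 1, so n is at least 2 and the
      expansion at zero is available. It also gives t < 1, which makes v w tend to infinity.\<close>
    then have "n \<noteq> 1" using 3(1) by auto
    define m where "m = n - 2"
    have nm: "n = Suc (Suc m)" using n \<open>n \<noteq> 1\<close> by (simp add: m_def)
    have "real n \<ge> 2" by (simp add: nm)
    then have "real n * t \<ge> 2 * t" using d(2) by (intro mult_right_mono) auto
    then have t1: "t < 1" using 3(2) by simp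
    obtain u where u: "good u" "Re (\<rho> * u ^ 1) < 0"
      using exists_good_halfplane(2)[OF p(2), of 1 "{}"] by auto
    have W0: "((\<lambda>r. W u r j) \<longlongrightarrow> 0) at_top" for j
      by (rule W_zero) (use dd sgn[of u] u d(2) in \<open>auto simp: mult_pos_neg\<close>)
    then have W0': "filterlim (\<lambda>r. W u r j) (at 0) at_top" for j
      by (simp add: filterlim_at)
    obtain C D c' d' where CD: "c' \<noteq> 0" "(C \<longlongrightarrow> c') (at 0)" "(D \<longlongrightarrow> d') (at 0)"
      and fd: "\<And>s w j. (\<And>k. w k \<noteq> 0 \<and> w (Suc k) = \<nu> * w k \<and> s (Suc k) = 1 + (1 + w k) * s k) \<Longrightarrow>
        fdiff n s j = w j * (C (w j) * s j + D (w j))"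
      using fdiff_recurrence_zero[OF \<nu> 3(1), of m] unfolding nm by blast
    have C: "((\<lambda>r. C (W u r j)) \<longlongrightarrow> c') at_top" and D: "((\<lambda>r. D (W u r j)) \<longlongrightarrow> d') at_top" for j
      by (rule filterlim_compose[OF CD(2) W0'] filterlim_compose[OF CD(3) W0'])+
    define Y where "Y r j = V u r 0 * W u r j" for r j
    have Ynz: "Y r j \<noteq> 0" for r j by (simp add: Y_def)
    define e where "e = d - p"
    have e: "e = [:b' - b, of_real (t - 1) * \<rho>:]"
      by (simp add: e_def p d algebra_simps)
    have ede: "degree e = 1" "lead_coeff e = of_real (t - 1) * \<rho>"
      using t1 p(2) unfolding e by auto
    have Y0: "Y r 0 = exp (poly e (of_real r * u + 0))" for r
      by (simp add: Y_def V_def W_def e_def exp_diff exp_minus field_simps)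
    have "lead_coeff e * u ^ degree e = of_real (t - 1) * (\<rho> * u)"
      by (simp only: ede(2)) (simp add: ede(1))
    then have slope: "Re (lead_coeff e * u ^ degree e) = (t - 1) * Re (\<rho> * u)"
      by (simp only: Re_of_real_mult)
    have "filterlim (\<lambda>r. Y r 0) at_infinity at_top"
      unfolding Y0 by (rule exp_poly_ray_infinity) (use ede slope t1 u in \<open>auto simp: mult_neg_neg\<close>)
    then have "((\<lambda>r. inverse (Y r 0)) \<longlongrightarrow> 0) at_top"
      by (rule filterlim_compose[OF tendsto_inverse_0])
    then have iY0: "((\<lambda>r. inverse (\<nu> ^ j) * inverse (Y r 0)) \<longlongrightarrow> inverse (\<nu> ^ j) * 0) at_top" for j
      by (intro tendsto_mult tendsto_const)
    have Yj: "Y r j = \<nu> ^ j * Y r 0" for r j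
      by (simp add: Y_def Wj[of u r j])
    have iY: "((\<lambda>r. inverse (Y r j)) \<longlongrightarrow> 0) at_top" for j
      using iY0[of j] unfolding Yj[of _ j] by simp
    define L where "L = (0 - d') / (c' - 0)"
    have Qlim: "((\<lambda>r. Q u r j) \<longlongrightarrow> L) at_top" for j
    proof -
      have den: "((\<lambda>r. C (W u r j) - inverse (Y r j)) \<longlongrightarrow> c' - 0) at_top"
        by (intro tendsto_diff C iY)
      have "((\<lambda>r. (inverse (Y r j) - D (W u r j)) / (C (W u r j) - inverse (Y r j))) \<longlongrightarrow> L) at_top"
        using CD(1) unfolding L_def by (intro tendsto_divide den tendsto_diff iY D) auto
      moreover have "eventually (\<lambda>r. C (W u r j) - inverse (Y r j) \<noteq> 0) at_top"
        using CD(1) by (intro tendsto_imp_eventually_ne[OF den]) simp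
      then have "eventually (\<lambda>r. (inverse (Y r j) - D (W u r j)) / (C (W u r j) - inverse (Y r j)) = Q u r j) at_top"
        using pos
      proof eventually_elim
        case (elim r)
        have "fdiff n (Q u r) j = W u r j * (C (W u r j) * Q u r j + D (W u r j))"
          by (rule fd) (use Q_rec[OF u(1) elim(2)] W in auto)
        then have "Y r j * (C (W u r j) * Q u r j + D (W u r j)) = 1 + Q u r j"
          using eq[OF u(1) elim(2), of j] by (simp add: Y_def mult.assoc)
        then have "Q u r j * (C (W u r j) - inverse (Y r j)) = inverse (Y r j) - D (W u r j)"
          using Ynz[of r j] by (simp add: field_simps)
        then show ?case using elim(1) by (simp add: nonzero_divide_eq_eq)
      qed
      ultimately show ?thesis by (rule Lim_transform_eventually)
    qed
    have "((\<lambda>r. 1 + (1 + W u r 0) * Q u r 0) \<longlongrightarrow> 1 + (1 + 0) * L) at_top"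
      by (intro tendsto_add tendsto_mult tendsto_const W0 Qlim)
    moreover have "eventually (\<lambda>r. 1 + (1 + W u r 0) * Q u r 0 = Q u r 1) at_top"
      using pos by eventually_elim (use Q_rec[OF u(1), of _ 0] in simp)
    ultimately have "((\<lambda>r. Q u r 1) \<longlongrightarrow> 1 + (1 + 0) * L) at_top"
      by (rule Lim_transform_eventually)
    then have "L = 1 + (1 + 0) * L" using tendsto_unique[OF nz] Qlim by blast
    then show False by simp
  qed
qed

lemma linear_p:
  assumes "degree p > 0" "degree dp = 0"
  obtains b \<rho> where "p = [:b, \<rho>:]" "\<rho> \<noteq> 0"
proof -
  have "degree p = 1" using assms degree_dp_zero_imp by simp
  then obtain b \<rho> where "p = [:b, \<rho>:]" "\<rho> \<noteq> 0"
    by (metis degree1_coeffs)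
  then show ?thesis by (rule that)
qed

lemma V_linear:
  assumes "p = [:b, \<rho>:]"
  shows "V u r (j + k) = exp (- (\<rho> * c)) ^ k * V u r j"
proof (induction k)
  case (Suc k)
  have "poly p z = b + z * \<rho>" for z using assms by simp
  then have "V u r (j + Suc k) = exp (- (\<rho> * c)) * V u r (j + k)"
    by (simp add: V_def algebra_simps flip: exp_add)
  with Suc show ?case by simp
qed simp

text \<open>On every ray with w -> 0 the limit recurrence is L = 1 + L. Each case therefore only has
  to supply such a ray with a nondegenerate limit, apart from the configuration of
  \<open>linear_case_False\<close>.\<close>

lemma degree_d: "degree d = 0"
proof (rule ccontr)
  assume "degree d \<noteq> 0"
  then have d: "degree d > 0" "lead_coeff d \<noteq> 0" by auto
  have W: "((\<lambda>r. W u r k) \<longlongrightarrow> 0) at_top" if "Re (lead_coeff d * u ^ degree d) < 0" for u k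
    by (rule W_zero[OF d(1) that])
  have V_pos: False
    if "good u" "Re (lead_coeff d * u ^ degree d) < 0" "degree p > 0" "Re (lead_coeff p * u ^ degree p) > 0" for u
    using limit_V_zero[OF that(1) W[OF that(2)] V_zero[OF that(3,4)]] by simp
  consider "degree p = 0" | "degree p > 0" "degree dp > 0" | "degree p > 0" "degree dp = 0" by blast
  then show False
  proof cases
    case 1
    obtain u where u: "good u" "Re (lead_coeff d * u ^ degree d) < 0"
      using exists_good_halfplane(2)[OF d(2,1), of "{}"] by auto
    obtain b where "p = [:b:]" using 1 by (rule degree_eq_zeroE)
    then have b: "poly p z = b" for z by simp
    \<comment> \<open>For constant v the n-th difference of the coefficients is 0, which differs
      from \<epsilon> = 1.\<close>
    have "\<exists>L. L = 1 + (1 + 0) * L \<and> L * fdiff n (\<lambda>_. exp (- b)) 0 = 1 * (1 + L)"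
      by (rule limit_equations[OF u(1) W[OF u(2)], where q = "\<lambda>_ _. 1"])
         (use n in \<open>auto simp: fdiff_const V_def b\<close>)
    then show False by simp
  next
    case 2
    have "lead_coeff p \<noteq> 0" "lead_coeff dp \<noteq> 0" using 2 by auto
    then have "countable ({u. norm u = 1 \<and> Re (lead_coeff p * u ^ degree p) = 0} \<union>
        {u. norm u = 1 \<and> Re (lead_coeff dp * u ^ degree dp) = 0})"
      using 2 by (intro countable_Un countable_unit_Re_zero) auto
    from exists_good_halfplane(2)[OF d(2,1) this] obtain u where
      u: "good u" "Re (lead_coeff d * u ^ degree d) < 0"
        "Re (lead_coeff p * u ^ degree p) \<noteq> 0" "Re (lead_coeff dp * u ^ degree dp) \<noteq> 0"
      by (auto simp: good_def)
    show False
    proof (cases "Re (lead_coeff p * u ^ degree p) > 0")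
      case True
      then show False using V_pos u 2 by blast
    next
      case False
      then have "Re (lead_coeff p * u ^ degree p) < 0" using u(3) by simp
      then show False using dominant_V[OF u(1) W[OF u(2)] _ 2(1) _ 2(2) u(4)] by simp
    qed
  next
    case 3
    obtain b \<rho> where p: "p = [:b, \<rho>:]" "\<rho> \<noteq> 0" using linear_p[OF 3] .
    have lp: "lead_coeff p * u ^ degree p = \<rho> * u ^ 1" for u
      using p(2) unfolding p(1) by simp
    \<comment> \<open>With linear p the ratio v(z + c) / v(z) is the constant \<mu>. When v ->
      infinity the coefficient is (\<mu> - 1)^n, so \<mu> = 1 is the degenerate case and requires a
      ray with v -> 0.\<close>
    define \<mu> where "\<mu> = exp (- (\<rho> * c))"
    show False
    proof (cases "\<mu> = 1")
      case False
      have "countable {u. norm u = 1 \<and> Re (\<rho> * u ^ 1) = 0}"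
        by (rule countable_unit_Re_zero) (use p in auto)
      from exists_good_halfplane(2)[OF d(2,1) this] obtain u where
        u: "good u" "Re (lead_coeff d * u ^ degree d) < 0" "Re (\<rho> * u ^ 1) \<noteq> 0"
        by (auto simp: good_def)
      have "\<not> Re (\<rho> * u ^ 1) > 0" using V_pos[OF u(1,2) 3(1)] unfolding lp by blast
      then have neg: "Re (\<rho> * u ^ 1) < 0" using u(3) by linarith
      have "((\<lambda>r. exp (poly p (of_real r * u + of_nat j * c))) \<longlongrightarrow> 0) at_top" for j
        by (rule exp_poly_ray_zero) (use 3 neg in \<open>simp_all only: lp\<close>)
      then have Vinf: "((\<lambda>r. 1 / V u r j) \<longlongrightarrow> 0) at_top" for j
        by (simp add: V_def exp_minus inverse_eq_divide[symmetric])
      have "\<exists>L. L = 1 + (1 + 0) * L \<and> L * fdiff n (\<lambda>k. \<mu> ^ k) 0 = 0 * (1 + L)"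
        by (rule limit_equations[OF u(1) W[OF u(2)], where q = "V u"])
           (use Vinf False in \<open>auto simp: V_linear[OF p(1)] \<mu>_def[symmetric] fdiff_power\<close>)
      then show False by simp
    next
      case True
      have e1: "exp (\<rho> * c) = 1" using True unfolding \<mu>_def exp_minus by (metis inverse_1 inverse_inverse_eq)
      show False
      proof (cases "degree d = 1 \<and> (\<exists>t>0. lead_coeff d = of_real t * \<rho>)")
        case True
        then obtain t where t: "t > 0" "degree d = 1" "lead_coeff d = of_real t * \<rho>" by blast
        then obtain b' l where "d = [:b', l:]" by (metis degree1_coeffs)
        then have "d = [:b', of_real t * \<rho>:]" using t by auto
        then show False using linear_case_False[OF p e1 _ t(1)] by blast
      next
        case False
        have "\<exists>u. norm u = 1 \<and> Re (\<rho> * u) > 0 \<and> Re (lead_coeff d * u ^ degree d) < 0"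
          by (rule exists_unit_two_signs) (use p d False in auto)
        then obtain u0 where u0: "norm u0 = 1" "Re (\<rho> * u0) > 0" "Re (lead_coeff d * u0 ^ degree d) < 0"
          by blast
        have "open ({u. Re (\<rho> * u) > 0} \<inter> {u. Re (lead_coeff d * u ^ degree d) < 0})"
          by (intro open_Int open_Collect_less continuous_intros)
        then obtain u where "good u" "Re (\<rho> * u) > 0" "Re (lead_coeff d * u ^ degree d) < 0"
          using exists_good[of _ u0 "{}"] u0 by blast
        then show False using V_pos[OF _ _ 3(1)] unfolding lp by simp
      qed
    qed
  qed
qed

text \<open>With w constant, a ray with v -> 0 gives w = 1. If the ratio of v is not constant, a ray
  with v -> infinity contradicts \<open>dominant_V\<close>; if it is, the orbit is solved
  explicitly. Once p is constant too, \<open>constant_coefficients\<close> applies.\<close>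

lemma exp_eq_1: "exp (poly p z) = 1" "exp (poly d z) = 1"
proof -
  obtain b' where "d = [:b':]" using degree_d by (rule degree_eq_zeroE)
  then have b': "poly d z = b'" for z by simp
  define w where "w = exp b'"
  have W: "W u r k = w" for u r k by (simp add: W_def b' w_def)
  have Wlim: "((\<lambda>r. W u r k) \<longlongrightarrow> w) at_top" for u k by (simp add: W)
  have pos: "eventually (\<lambda>r::real. r > 0) at_top" by (rule eventually_gt_at_top)
  have nz: "at_top \<noteq> (bot :: real filter)" by simp
  have "degree p = 0"
  proof (rule ccontr)
    assume "degree p \<noteq> 0"
    then have dp0: "degree p > 0" "lead_coeff p \<noteq> 0" by auto
    obtain u where u: "good u" "Re (lead_coeff p * u ^ degree p) > 0"
      using exists_good_halfplane(1)[OF dp0(2,1), of "{}"] by auto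
    have V0: "((\<lambda>r. V u r k) \<longlongrightarrow> 0) at_top" for k by (rule V_zero[OF dp0(1) u(2)])
    have w1: "w = 1" by (rule limit_V_zero[OF u(1) Wlim V0])
    show False
    proof (cases "degree dp = 0")
      case False
      then have ddp: "degree dp > 0" "lead_coeff dp \<noteq> 0" by auto
      have "countable {u. norm u = 1 \<and> Re (lead_coeff dp * u ^ degree dp) = 0}"
        by (rule countable_unit_Re_zero) (use ddp in auto)
      from exists_good_halfplane(2)[OF dp0(2,1) this] obtain u' where
        u': "good u'" "Re (lead_coeff p * u' ^ degree p) < 0" "Re (lead_coeff dp * u' ^ degree dp) \<noteq> 0"
        by (auto simp: good_def)
      show False
        using dominant_V[OF u'(1) Wlim _ dp0(1) u'(2) ddp(1) u'(3)] w1 by simp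
    next
      case True
      obtain b \<rho> where p: "p = [:b, \<rho>:]" "\<rho> \<noteq> 0" using linear_p[OF dp0(1) True] .
      define \<mu> where "\<mu> = exp (- (\<rho> * c))"
      define X where "X = (2 * \<mu> - 1) ^ n"
      define Y where "Y = (\<mu> - 1) ^ n"
      \<comment> \<open>For w = 1 the recurrence doubles Q + 1, so v Q is a combination of
        (2\<mu>)^k and \<mu>^k; differencing multiplies these by X and Y.\<close>
      have e: "V u r 0 * ((Q u r 0 + 1) * X * (2 * \<mu>) ^ j - Y * \<mu> ^ j) = 2 ^ j * (Q u r 0 + 1)"
        if r: "r > 0" for r j
      proof -
        have Q: "Q u r k = 2 ^ k * (Q u r 0 + 1) - 1" for k
        proof (induction k)
          case (Suc k)
          have "Q u r (Suc k) = 1 + 2 * Q u r k" by (simp add: Q_rec[OF u(1) r] W w1)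
          then show ?case unfolding Suc.IH by (simp add: algebra_simps)
        qed simp
        have "1 + Q u r j = fdiff n (\<lambda>k. V u r k * Q u r k) j"
          using Q_eqn[OF u(1) r] by simp
        also have "\<dots> = fdiff n (\<lambda>k. V u r 0 * (Q u r 0 + 1) * (2 * \<mu>) ^ k - V u r 0 * \<mu> ^ k) j"
        proof (rule fdiff_cong)
          fix k
          have "V u r k * Q u r k = \<mu> ^ k * V u r 0 * (2 ^ k * (Q u r 0 + 1) - 1)"
            using V_linear[OF p(1), of u r 0 k] Q[of k] by (simp add: \<mu>_def)
          then show "V u r k * Q u r k = V u r 0 * (Q u r 0 + 1) * (2 * \<mu>) ^ k - V u r 0 * \<mu> ^ k"
            by (simp add: power_mult_distrib algebra_simps)
        qed
        also have "\<dots> = V u r 0 * ((Q u r 0 + 1) * X * (2 * \<mu>) ^ j - Y * \<mu> ^ j)"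
          unfolding fdiff_diff fdiff_mult_left fdiff_power X_def Y_def by (simp add: algebra_simps)
        finally show ?thesis using Q[of j] by simp
      qed
      have h: "Q u r 0 + 1 \<noteq> 0" if "r > 0" for r
        using Q_ne[OF u(1) that] by (simp add: eq_neg_iff_add_eq_0)
      show False
      proof (cases "\<mu> = 1")
        case True
        \<comment> \<open>Here X = 1 and Y = 0, the latter because n > 0; cancelling the nonzero Q +
          1 leaves v = 1.\<close>
        then have "V u r 0 = 1" if "r > 0" for r
          using e[OF that, of 0] h[OF that] n by (simp add: X_def Y_def zero_power)
        then have "((\<lambda>r. V u r 0) \<longlongrightarrow> 1) at_top"
          by (intro tendsto_eventually) (auto intro: eventually_mono[OF pos])
        then show False using tendsto_unique[OF nz _ V0] by fastforce
      next
        case False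
        then have Y: "Y \<noteq> 0" by (simp add: Y_def)
        \<comment> \<open>The unknown h = Q + 1 is eliminated between the equations for j = 0 and j
          = 1, leaving a relation for v alone.\<close>
        have key: "(\<mu> - 2) * (1 - V u r 0 * X) = - 2 * X * (\<mu> - 1) * V u r 0" if r: "r > 0" for r
        proof -
          define v h where "v = V u r 0" and "h = Q u r 0 + 1"
          have v: "v \<noteq> 0" by (simp add: v_def)
          have e0: "v * (h * X - Y) = h" using e[OF r, of 0] by (simp add: v_def h_def)
          have e1: "v * (h * X * (2 * \<mu>) - Y * \<mu>) = 2 * h" using e[OF r, of 1] by (simp add: v_def h_def)
          have "v * (h * X * (2 * \<mu>) - Y * \<mu>) = v * (2 * (h * X - Y))"
            by (simp only: e0 e1 mult.left_commute[of v 2])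
          then have "h * X * (2 * \<mu>) - Y * \<mu> = 2 * (h * X - Y)" using v by simp
          then have s1: "2 * h * X * (\<mu> - 1) = Y * (\<mu> - 2)" by (simp add: algebra_simps)
          have s2: "h * (1 - v * X) = - (v * Y)" using e0 by (simp add: algebra_simps)
          have "Y * ((\<mu> - 2) * (1 - v * X)) = 2 * X * (\<mu> - 1) * (h * (1 - v * X))"
            unfolding mult.assoc[symmetric] s1[symmetric] by (simp add: mult_ac)
          also have "\<dots> = Y * (- 2 * X * (\<mu> - 1) * v)" unfolding s2 by (simp add: mult_ac)
          finally show ?thesis using Y unfolding v_def by (metis mult_left_cancel)
        qed
        have "((\<lambda>r. - 2 * X * (\<mu> - 1) * V u r 0) \<longlongrightarrow> - 2 * X * (\<mu> - 1) * 0) at_top"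
          by (intro tendsto_mult tendsto_const V0)
        moreover have "eventually (\<lambda>r. - 2 * X * (\<mu> - 1) * V u r 0 = (\<mu> - 2) * (1 - V u r 0 * X)) at_top"
          using pos by eventually_elim (simp only: key)
        ultimately have "((\<lambda>r. (\<mu> - 2) * (1 - V u r 0 * X)) \<longlongrightarrow> - 2 * X * (\<mu> - 1) * 0) at_top"
          by (rule Lim_transform_eventually)
        moreover have "((\<lambda>r. (\<mu> - 2) * (1 - V u r 0 * X)) \<longlongrightarrow> (\<mu> - 2) * (1 - 0 * X)) at_top"
          by (intro tendsto_mult tendsto_diff tendsto_const V0)
        ultimately have "(\<mu> - 2) * (1 - 0 * X) = - 2 * X * (\<mu> - 1) * 0"
          using tendsto_unique[OF nz] by blast
        then have "\<mu> = 2" by simp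
        \<comment> \<open>At \<mu> = 2 the relation \<open>key\<close> reads 0 = -2 * 3^n * v, but v
          is an exponential.\<close>
        then show False using key[of 1] by (simp add: X_def)
      qed
    qed
  qed
  then obtain b where "p = [:b:]" by (rule degree_eq_zeroE)
  then have b: "poly p z = b" for z by simp
  obtain u where u: "good u" using exists_good_halfplane(1)[of 1 1 "{}"] by auto
  have "w = 1 \<and> exp (- b) = 1"
  proof (rule constant_coefficients[OF n, of "Q u 1"])
    show "Q u 1 (Suc k) = 1 + (1 + w) * Q u 1 k" for k
      using Q_rec[OF u, of 1 k] by (simp add: W)
    show "fdiff n (\<lambda>k. exp (- b) * Q u 1 k) j = 1 + Q u 1 j" for j
      using Q_eqn[OF u, of 1 j] by (simp add: V_def b)
  qed (use Q_ne[OF u] in \<open>auto simp: w_def\<close>)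
  then show "exp (poly p z) = 1" "exp (poly d z) = 1"
    by (auto simp: b b' w_def exp_minus)
qed

end

theorem theorem1p1:
  fixes c :: complex and n :: nat and f a :: "complex \<Rightarrow> complex"
  assumes "n \<ge> 1"
    and "f holomorphic_on UNIV"
    and "\<not> f constant_on UNIV"
    and "growth_order f < \<infinity>"
    and "(difference c ^^ n) f \<noteq> (\<lambda>z. 0)"
    and "a holomorphic_on UNIV"
    and "a \<in> small_functions f"
    and "a \<noteq> (\<lambda>z. 0)"
    and "\<forall>z. a (z + c) = a z"
    and "share_CM a {f, (difference c ^^ n) f, (difference c ^^ (n + 1)) f}"
  shows "difference c f = f"
proof -
  define F where "F = (difference c ^^ n) f"
  define G where "G z = F z - a z" for z
  have per: "a (z + c) = a z" for z using assms(9) by simp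
  obtain p d where
    p: "\<And>z. F z - a z = exp (poly p z) * (f z - a z)" and
    d: "\<And>z. (difference c ^^ (n + 1)) f z - a z = exp (poly d z) * (F z - a z)"
    using share_CM_exp_polynomials[OF assms(1-7) per assms(10)] unfolding F_def by metis
  note aper = periodic_of_nat[of a, OF per]
  have c: "c \<noteq> 0"
  proof
    assume "c = 0"
    then have "F = (\<lambda>z. 0)"
      using assms(1) by (intro ext) (simp add: F_def funpow_difference fdiff_const)
    with assms(5) show False by (simp add: F_def)
  qed
  have holF: "F holomorphic_on UNIV"
    unfolding F_def by (rule holomorphic_funpow_difference[OF assms(2)])
  interpret shift_system c n a G p d
  proof
    show "c \<noteq> 0" "n > 0" "a holomorphic_on UNIV" "a (z + c) = a z" for z
      using c assms per by auto
    show "\<exists>z. a z \<noteq> 0" using assms(8) by blast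
    show "G holomorphic_on UNIV"
      unfolding G_def[abs_def] using holF assms(6) by (rule holomorphic_on_diff)
    show "\<exists>z. a z + G z \<noteq> 0" using assms(5) by (auto simp: G_def F_def)
    show "G (z + c) = a z + (1 + exp (poly d z)) * G z" for z
    proof -
      have "(difference c ^^ (n + 1)) f z = F (z + c) - F z"
        using funpow_difference_Suc[of n c f z] by (simp only: F_def Suc_eq_plus1)
      with d[of z] have "F (z + c) - F z - a z = exp (poly d z) * (F z - a z)" by (simp only:)
      then show ?thesis unfolding G_def per by (simp add: algebra_simps)
    qed
    show "fdiff n (\<lambda>k. exp (- poly p (z + of_nat k * c)) * G (z + of_nat k * c)) 0 = a z + G z" for z
    proof -
      \<comment> \<open>The system's difference equation is the n-th difference of f - a, in which
        \<open>a\<close> is constant along the orbit and drops out.\<close>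
      have "exp (- poly p y) * G y = f y - a y" for y
        using p[of y] by (simp add: G_def exp_minus field_simps)
      then have "fdiff n (\<lambda>k. exp (- poly p (z + of_nat k * c)) * G (z + of_nat k * c)) 0 =
          fdiff n (\<lambda>k. f (z + of_nat k * c) - a z) 0"
        by (simp add: aper)
      also have "\<dots> = F z"
        using assms(1) by (simp add: F_def funpow_difference fdiff_diff fdiff_const)
      finally show ?thesis by (simp add: G_def)
    qed
  qed
  \<comment> \<open>With both exponentials equal to 1, the n-th difference is f and the next one
    equals it, so the difference of f is f.\<close>
  have Ff: "F z = f z" for z using p[of z] by (simp add: exp_eq_1)
  show ?thesis
  proof
    fix z
    have "(difference c ^^ (n + 1)) f z = F (z + c) - F z"
      using funpow_difference_Suc[of n c f z] by (simp only: F_def Suc_eq_plus1)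
    moreover have "(difference c ^^ (n + 1)) f z = F z" using d[of z] by (simp add: exp_eq_1)
    ultimately show "difference c f z = f z" by (simp add: difference_def Ff)
  qed
qed

end
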